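(* Let $k\le n$ be positive integers and use the neglex term order on $\mathbb F[\mathbf x_n]$. The polynomials $h_k(x_1),h_k(x_1,x_2),\dots,h_k(x_1,\dots,x_n)$ together with the Demazure characters $\kappa_{\gamma(S)^*}(\mathbf x_n)$ for all $S\subseteq[n-1]$ with $|S|=n-k+1$ form a Gröbner basis of $J_{n,k}$. When $k<n$, this Gröbner basis is minimal.
   Context: $\mathbb F$ is a field, $\mathbb F[\mathbf x_n]=\mathbb F[x_1,\dots,x_n]$, $h_d$ denotes complete homogeneous and $e_d$ elementary symmetric polynomials; $J_{n,k}$ is the ideal generated by $h_k(x_1),\dots,h_k(x_1,\dots,x_n),e_n(\mathbf x_n),\dots,e_{n-k+1}(\mathbf x_n)$. Neglex is the lexicographic term order with $x_n>\cdots>x_1$. A Gröbner basis of $I$ is a finite subset $G\subseteq I$ whose leading monomials generate the initial ideal of $I$; it is minimal if all leading coefficients are $1$ and no leading monomial of one element divides that of another. The isobaric Demazure operator is $\pi_i(f)=\frac{x_if-x_{i+1}s_i(f)}{x_i-x_{i+1}}$, where $s_i$ swaps $x_i,x_{i+1}$. For a weak composition $\gamma=(\gamma_1,\dots,\gamma_n)$ (nonnegative integers), the Demazure character $\kappa_\gamma(\mathbf x_n)$ is defined recursively: $\kappa_\gamma=x_1^{\gamma_1}\cdots x_n^{\gamma_n}$ if $\gamma$ is weakly decreasing, and $\kappa_\gamma=\pi_i(\kappa_{s_i\gamma})$ if $\gamma_i<\gamma_{i+1}$, where $s_i\gamma$ swaps the entries in positions $i,i+1$. For $S=\{s_1<\cdots<s_m\}\subseteq[n]$,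 $\gamma(S)=(\gamma_1,\dots,\gamma_n)$ with $\gamma_{s_j}=s_j-j+1$ and $\gamma_i=0$ for $i\notin S$, and $\gamma(S)^*=(\gamma_n,\dots,\gamma_1)$ is its reversal. *)

theory Defs
  imports Main "HOL-Library.Poly_Mapping"
begin

text \<open>Multivariate polynomials over a field: finitely supported maps from
monomials (exponent vectors, variable x_i has index i, i = 1..n) to coefficients.\<close>

type_synonym mon = "nat \<Rightarrow>\<^sub>0 nat"
type_synonym 'a mpoly = "mon \<Rightarrow>\<^sub>0 'a"

definition mdeg :: "mon \<Rightarrow> nat" where
  "mdeg \<alpha> = (\<Sum>i\<in>Poly_Mapping.keys \<alpha>. Poly_Mapping.lookup \<alpha> i)"

definition in_vars :: "nat \<Rightarrow> mon \<Rightarrow> bool" where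
  "in_vars n \<alpha> \<longleftrightarrow> Poly_Mapping.keys \<alpha> \<subseteq> {1..n}"

definition poly_ring :: "nat \<Rightarrow> ('a::field) mpoly set" where
  "poly_ring n = {p. \<forall>\<alpha>\<in>Poly_Mapping.keys p. in_vars n \<alpha>}"

inductive_set ideal_gen :: "nat \<Rightarrow> ('a::field) mpoly set \<Rightarrow> 'a mpoly set"
  for n :: nat and G :: "'a mpoly set" where
  zero: "0 \<in> ideal_gen n G"
| gen: "g \<in> G \<Longrightarrow> g \<in> ideal_gen n G"
| add: "f \<in> ideal_gen n G \<Longrightarrow> g \<in> ideal_gen n G \<Longrightarrow> f + g \<in> ideal_gen n G"
| mult: "q \<in> poly_ring n \<Longrightarrow> f \<in> ideal_gen n G \<Longrightarrow> q * f \<in> ideal_gen n G"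

definition h_poly :: "nat \<Rightarrow> nat \<Rightarrow> ('a::field) mpoly" where
  "h_poly d m = (\<Sum>\<alpha>\<in>{\<alpha>. in_vars m \<alpha> \<and> mdeg \<alpha> = d}. Poly_Mapping.single \<alpha> 1)"

definition e_poly :: "nat \<Rightarrow> nat \<Rightarrow> ('a::field) mpoly" where
  "e_poly d m = (\<Sum>\<alpha>\<in>{\<alpha>. in_vars m \<alpha> \<and> mdeg \<alpha> = d \<and> (\<forall>i. Poly_Mapping.lookup \<alpha> i \<le> 1)}.
      Poly_Mapping.single \<alpha> 1)"

definition J_ideal :: "nat \<Rightarrow> nat \<Rightarrow> ('a::field) mpoly set" where
  "J_ideal n k = ideal_gen n ({h_poly k i | i. i \<in> {1..n}} \<union> {e_poly d n | d. d \<in> {n-k+1..n}})"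

definition neglex_le :: "mon \<Rightarrow> mon \<Rightarrow> bool" where
  "neglex_le \<alpha> \<beta> \<longleftrightarrow> \<alpha> = \<beta> \<or>
     (\<exists>i. Poly_Mapping.lookup \<alpha> i < Poly_Mapping.lookup \<beta> i \<and> (\<forall>j>i. Poly_Mapping.lookup \<alpha> j = Poly_Mapping.lookup \<beta> j))"

definition lm :: "('a::field) mpoly \<Rightarrow> mon" where
  "lm p = (THE m. m \<in> Poly_Mapping.keys p \<and> (\<forall>m'\<in>Poly_Mapping.keys p. neglex_le m' m))"

definition lc :: "('a::field) mpoly \<Rightarrow> 'a" where
  "lc p = Poly_Mapping.lookup p (lm p)"

definition mon_dvd :: "mon \<Rightarrow> mon \<Rightarrow> bool" where
  "mon_dvd \<alpha> \<beta> \<longleftrightarrow> (\<forall>i. Poly_Mapping.lookup \<alpha> i \<le> Poly_Mapping.lookup \<beta> i)"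

definition lm_ideal :: "nat \<Rightarrow> ('a::field) mpoly set \<Rightarrow> 'a mpoly set" where
  "lm_ideal n A = ideal_gen n {Poly_Mapping.single (lm f) 1 | f. f \<in> A \<and> f \<noteq> 0}"

definition initial_ideal :: "nat \<Rightarrow> ('a::field) mpoly set \<Rightarrow> 'a mpoly set" where
  "initial_ideal n I = lm_ideal n I"

definition is_groebner_basis :: "nat \<Rightarrow> ('a::field) mpoly set \<Rightarrow> 'a mpoly set \<Rightarrow> bool" where
  "is_groebner_basis n G I \<longleftrightarrow> finite G \<and> G \<subseteq> I \<and> lm_ideal n G = initial_ideal n I"

definition is_minimal_groebner_basis :: "nat \<Rightarrow> ('a::field) mpoly set \<Rightarrow> 'a mpoly set \<Rightarrow> bool" where
  "is_minimal_groebner_basis n G I \<longleftrightarrow> is_groebner_basis n G I \<and>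
     (\<forall>g\<in>G. g \<noteq> 0 \<and> lc g = 1) \<and>
     (\<forall>g\<in>G. \<forall>g'\<in>G. g \<noteq> g' \<longrightarrow> \<not> mon_dvd (lm g) (lm g'))"

definition var :: "nat \<Rightarrow> ('a::field) mpoly" where
  "var i = Poly_Mapping.single (Poly_Mapping.single i 1) 1"

definition swap_idx :: "nat \<Rightarrow> nat \<Rightarrow> nat" where
  "swap_idx i j = (if j = i then i + 1 else if j = i + 1 then i else j)"

definition swap_mon :: "nat \<Rightarrow> mon \<Rightarrow> mon" where
  "swap_mon i \<alpha> = (\<Sum>j\<in>Poly_Mapping.keys \<alpha>. Poly_Mapping.single (swap_idx i j) (Poly_Mapping.lookup \<alpha> j))"

definition swap_poly :: "nat \<Rightarrow> ('a::field) mpoly \<Rightarrow> 'a mpoly" where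
  "swap_poly i f = (\<Sum>\<alpha>\<in>Poly_Mapping.keys f. Poly_Mapping.single (swap_mon i \<alpha>) (Poly_Mapping.lookup f \<alpha>))"

text \<open>Isobaric Demazure operator pi_i f = (x_i f - x_{i+1} s_i f)/(x_i - x_{i+1}),
the quotient being the (unique) exact polynomial quotient.\<close>
definition demazure_op :: "nat \<Rightarrow> ('a::field) mpoly \<Rightarrow> 'a mpoly" where
  "demazure_op i f = (THE g. (var i - var (i+1)) * g = var i * f - var (i+1) * swap_poly i f)"

text \<open>Weak compositions of length n are lists; gamma_j = gamma ! (j-1).\<close>
definition xpow :: "nat list \<Rightarrow> ('a::field) mpoly" where
  "xpow \<gamma> = Poly_Mapping.single (\<Sum>j<length \<gamma>. Poly_Mapping.single (j+1) (\<gamma> ! j)) 1"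

definition swap_comp :: "nat \<Rightarrow> nat list \<Rightarrow> nat list" where
  "swap_comp i \<gamma> = \<gamma>[i - 1 := \<gamma> ! i, i := \<gamma> ! (i - 1)]"

definition has_ascent :: "nat list \<Rightarrow> nat \<Rightarrow> bool" where
  "has_ascent \<gamma> i \<longleftrightarrow> 1 \<le> i \<and> i < length \<gamma> \<and> \<gamma> ! (i - 1) < \<gamma> ! i"

text \<open>Recursive definition of Demazure characters: if gamma is weakly decreasing,
kappa = x^gamma, otherwise kappa_gamma = pi_i(kappa_{s_i gamma}) for the least ascent i.
The counter bounds the recursion depth; the number of inversions of gamma
(< length^2) is always enough, so the counter never runs out.\<close>
fun kappa_aux :: "nat \<Rightarrow> nat list \<Rightarrow> ('a::field) mpoly" where
  "kappa_aux 0 \<gamma> = xpow \<gamma>"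
| "kappa_aux (Suc f) \<gamma> =
     (if \<not> (\<exists>i. has_ascent \<gamma> i) then xpow \<gamma>
      else (let i = (LEAST i. has_ascent \<gamma> i) in demazure_op i (kappa_aux f (swap_comp i \<gamma>))))"

definition kappa :: "nat list \<Rightarrow> ('a::field) mpoly" where
  "kappa \<gamma> = kappa_aux (length \<gamma> * length \<gamma>) \<gamma>"

text \<open>gamma(S) for S \<subseteq> [n]: entry s_j is s_j - j + 1.\<close>
definition gammaS :: "nat \<Rightarrow> nat set \<Rightarrow> nat list" where
  "gammaS n S = map (\<lambda>p. if p + 1 \<in> S then (p + 1) - card {t\<in>S. t \<le> p + 1} + 1 else 0) [0..<n]"

definition GB_set :: "nat \<Rightarrow> nat \<Rightarrow> ('a::field) mpoly set" where
  "GB_set n k = {h_poly k i | i. i \<in> {1..n}} \<union>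
     {kappa (rev (gammaS n S)) | S. S \<subseteq> {1..n-1} \<and> card S = n - k + 1}"

end

theory Submission
  imports Defs "HOL-Computational_Algebra.Formal_Power_Series" "Jordan_Normal_Form.Determinant"
begin

text \<open>
  The nonzero parts of \<open>\<gamma>(S)\<^sup>*\<close> are weakly decreasing, so its Demazure character is the flagged Schur
  polynomial \<open>det (h\<^bsub>v\<^sub>a - a + b\<^esub>(x\<^sub>1, \<dots>, x\<^bsub>p\<^sub>a\<^esub>))\<close>, where \<open>p\<^sub>a\<close> and \<open>v\<^sub>a\<close> are the position and the value of
  the \<open>a\<close>-th nonzero part: each Demazure operator moves the flag of a single row. The Leibniz formula
  shows that its leading monomial is \<open>x\<close> to the power \<open>\<gamma>(S)\<^sup>*\<close>, and a linear relation between the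
  columns modulo \<open>e\<^sub>j\<close> with \<open>j > n - k\<close> puts it into \<open>J\<^bsub>n,k\<^esub>\<close>.

  That there are no further leading monomials follows from orbit harmonics. Let \<open>Y\<close> be the set of points
  \<open>(y\<^sub>1, \<dots>, y\<^sub>n)\<close> with distinct coordinates, \<open>y\<^sub>i\<close> among the first \<open>k + i - 1\<close> of a list of distinct
  scalars, such that the first \<open>k\<close> scalars all occur. The generators of \<open>J\<^bsub>n,k\<^esub>\<close> are top degree
  components of polynomials that vanish on \<open>Y\<close>, and \<open>Y\<close> has as many points as there are monomials not
  divisible by the known leading monomials. If one of these monomials were a leading monomial of an
  element of \<open>J\<^bsub>n,k\<^esub>\<close>, a nontrivial weight on \<open>Y\<close> would annihilate the remaining ones, hence, by
  induction along the degree and the term order, all monomials; interpolation rules this out.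
\<close>

section \<open>Complete homogeneous and elementary symmetric polynomials\<close>

text \<open>The bounds on the points are dictated by cancellation of factors 1 - y t. The
  coordinates y_1, ..., y_i use i of the first k + i - 1 scalars; k - 1 factors remain, so a
  coefficient of t^k vanishes whose top part is h_k(x_1, ..., x_i). If the first k scalars all
  occur, n - k factors remain, and the coefficients of t^d with d > n - k vanish, with top parts e_d
  up to sign. The same cancellation yields the column operations on flagged determinants, which is
  why both families are treated as power series. The two cardinalities are compared without a
  bijection: both equal k! h_{n-k}(0, 1, ..., k), the number of ordered set partitions of n elements
  into k blocks. Each obeys a recursion in the number e of requirements still open, solved by a
  complete homogeneous polynomial over an alphabet with e + 1 letters; the two alphabets differ on
  the way and coincide at e = k. Only an inequality is used in the end: one candidate fewer than
  points means fewer equations than unknown weights, so no quotient ring and no dimension has to be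
  formalised.\<close>

definition hgen :: "('i \<Rightarrow> 'b::comm_ring_1) \<Rightarrow> 'i set \<Rightarrow> 'b fps" where
  "hgen x A = (\<Prod>i\<in>A. Abs_fps (\<lambda>r. x i ^ r))"

text \<open>This product is the inverse of \<open>hgen\<close>, so identities between symmetric
  polynomials become cancellations of factors.\<close>

definition egen :: "('i \<Rightarrow> 'b::comm_ring_1) \<Rightarrow> 'i set \<Rightarrow> 'b fps" where
  "egen x A = (\<Prod>i\<in>A. 1 - fps_const (x i) * fps_X)"

text \<open>Ring and index set are left free, because the same recursions are applied to variables,
  nodes, points and, for the counting, integers.\<close>

definition hsym :: "('i \<Rightarrow> 'b::comm_ring_1) \<Rightarrow> 'i set \<Rightarrow> nat \<Rightarrow> 'b" where
  "hsym x A d = fps_nth (hgen x A) d"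

text \<open>Elementary symmetric polynomials, with the sign $(-1)^d$ built in.\<close>

definition esym :: "('i \<Rightarrow> 'b::comm_ring_1) \<Rightarrow> 'i set \<Rightarrow> nat \<Rightarrow> 'b" where
  "esym x A d = fps_nth (egen x A) d"

lemma fps_geometric_mult:
  fixes a :: "'b::comm_ring_1"
  shows "(1 - fps_const a * fps_X) * Abs_fps (\<lambda>r. a ^ r) = 1"
proof (rule fps_ext)
  fix d
  show "fps_nth ((1 - fps_const a * fps_X) * Abs_fps (\<lambda>r. a ^ r)) d = fps_nth 1 d"
    by (cases d) (simp_all add: left_diff_distrib mult.assoc)
qed

lemma egen_mult_hgen_same:
  "finite A \<Longrightarrow> egen x A * hgen x A = 1"
  by (simp add: egen_def hgen_def prod.distrib[symmetric] fps_geometric_mult)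

lemma egen_split: "finite A \<Longrightarrow> B \<subseteq> A \<Longrightarrow> egen x A = egen x (A - B) * egen x B"
  unfolding egen_def by (metis prod.subset_diff)

lemma hgen_split: "finite A \<Longrightarrow> B \<subseteq> A \<Longrightarrow> hgen x A = hgen x (A - B) * hgen x B"
  unfolding hgen_def by (metis prod.subset_diff)

text \<open>The factors indexed by \<open>A\<close> cancel. What remains is a polynomial of degree
  at most \<open>card (B - A)\<close>, and the vanishing results below are its missing higher
  coefficients, by \<open>esym_eq_0\<close>.\<close>

lemma egen_mult_hgen_subset:
  assumes "finite B" "A \<subseteq> B"
  shows "egen x B * hgen x A = egen x (B - A)"
  using egen_split[OF assms, of x] egen_mult_hgen_same[of A x] assms
  by (simp add: mult.assoc finite_subset)

lemma egen_mult_hgen_superset: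
  assumes "finite A" "B \<subseteq> A"
  shows "egen x B * hgen x A = hgen x (A - B)"
proof -
  have "egen x B * hgen x A = hgen x (A - B) * (egen x B * hgen x B)"
    using hgen_split[OF assms, of x] by (simp add: mult_ac)
  then show ?thesis using egen_mult_hgen_same[of B x] assms by (simp add: finite_subset)
qed

lemma hgen_reindex: "inj_on l A \<Longrightarrow> hgen (\<lambda>i. x (l i)) A = hgen x (l ` A)"
  unfolding hgen_def by (simp add: prod.reindex)

lemma egen_reindex: "inj_on l A \<Longrightarrow> egen (\<lambda>i. x (l i)) A = egen x (l ` A)"
  unfolding egen_def by (simp add: prod.reindex)

lemma hsym_reindex: "inj_on l A \<Longrightarrow> hsym (\<lambda>i. x (l i)) A = hsym x (l ` A)"
  by (simp add: hsym_def hgen_reindex fun_eq_iff)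

lemma hsym_0 [simp]: "finite A \<Longrightarrow> hsym x A 0 = 1"
  unfolding hsym_def hgen_def by (induction A rule: finite_induct) auto

lemma esym_0 [simp]: "finite A \<Longrightarrow> esym x A 0 = 1"
  unfolding esym_def egen_def by (induction A rule: finite_induct) auto

lemma hsym_empty [simp]: "hsym x {} (Suc d) = 0"
  by (simp add: hsym_def hgen_def)

lemma hsym_singleton [simp]: "hsym x {a} d = x a ^ d"
  by (simp add: hsym_def hgen_def)

text \<open>Multiplication by 1 - x_a t removes the factor of \<open>a\<close> from the series. This
  recursion drives the sums over monomials and both counting arguments.\<close>

lemma hsym_insert:
  assumes "finite A" "a \<notin> A"
  shows "hsym x (insert a A) (Suc d) = hsym x A (Suc d) + x a * hsym x (insert a A) d"
proof -
  have "hgen x A = (1 - fps_const (x a) * fps_X) * hgen x (insert a A)"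
    using egen_mult_hgen_superset[of "insert a A" "{a}" x] assms by (simp add: egen_def)
  then have "hsym x A (Suc d) = fps_nth ((1 - fps_const (x a) * fps_X) * hgen x (insert a A)) (Suc d)"
    by (simp add: hsym_def)
  also have "\<dots> = hsym x (insert a A) (Suc d) - x a * hsym x (insert a A) d"
    by (simp add: left_diff_distrib mult.assoc hsym_def)
  finally show ?thesis by simp
qed

lemma esym_insert:
  assumes "finite A" "a \<notin> A"
  shows "esym x (insert a A) (Suc d) = esym x A (Suc d) - x a * esym x A d"
proof -
  have "egen x (insert a A) = (1 - fps_const (x a) * fps_X) * egen x A"
    unfolding egen_def using assms by simp
  then show ?thesis
    by (simp add: left_diff_distrib mult.assoc esym_def)
qed

lemma esym_eq_0:
  assumes "finite A" "card A < d"
  shows "esym x A d = 0"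
  using assms
proof (induction A arbitrary: d rule: finite_induct)
  case empty
  then show ?case by (simp add: esym_def egen_def)
next
  case (insert a A)
  then obtain e where "d = Suc e" by (cases d) auto
  with insert show ?case by (simp add: esym_insert)
qed

lemma esym_hsym_convolution:
  "(\<Sum>j\<le>d. esym x B j * hsym y A (d - j)) = fps_nth (egen x B * hgen y A) d"
  by (simp add: fps_mult_nth hsym_def esym_def atLeast0AtMost)

text \<open>Uses (a - b) H = a (1 - b t) H - b (1 - a t) H, where each bracket clears one factor of
  H. For a = x_i and b = x_{i+1} this is the computation of pi_i on a complete homogeneous
  polynomial.\<close>

lemma hsym_difference:
  assumes "finite A" "a \<notin> A" "b \<notin> A" "a \<noteq> b"
  shows "(x a - x b) * hsym x (insert a (insert b A)) d =
    x a * hsym x (insert a A) d - x b * hsym x (insert b A) d"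
proof -
  let ?H = "hgen x (insert a (insert b A))"
  have a: "(1 - fps_const (x b) * fps_X) * ?H = hgen x (insert a A)"
    using egen_mult_hgen_superset[of "insert a (insert b A)" "{b}" x] assms
    by (simp add: egen_def insert_Diff_if)
  have b: "(1 - fps_const (x a) * fps_X) * ?H = hgen x (insert b A)"
    using egen_mult_hgen_superset[of "insert a (insert b A)" "{a}" x] assms
    by (simp add: egen_def insert_Diff_if)
  have "fps_const (x a - x b) * ?H =
      fps_const (x a) * ((1 - fps_const (x b) * fps_X) * ?H)
      - fps_const (x b) * ((1 - fps_const (x a) * fps_X) * ?H)"
    by (simp add: fps_const_sub[symmetric] algebra_simps del: fps_const_sub)
  then have "fps_nth (fps_const (x a - x b) * ?H) d =
    fps_nth (fps_const (x a) * hgen x (insert a A) - fps_const (x b) * hgen x (insert b A)) d"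
    unfolding a b by simp
  then show ?thesis by (simp add: hsym_def)
qed

section \<open>Monomials of a given degree and the sums of their values\<close>

lemma mdeg_superset:
  assumes "finite A" "Poly_Mapping.keys \<alpha> \<subseteq> A"
  shows "mdeg \<alpha> = (\<Sum>i\<in>A. Poly_Mapping.lookup \<alpha> i)"
  unfolding mdeg_def using assms by (intro sum.mono_neutral_left) (auto simp: in_keys_iff)

lemma mdeg_0 [simp]: "mdeg 0 = 0"
  by (simp add: mdeg_def)

lemma mdeg_single [simp]: "mdeg (Poly_Mapping.single i c) = c"
  by (simp add: mdeg_def)

lemma mdeg_add: "mdeg (\<alpha> + \<beta>) = mdeg \<alpha> + mdeg \<beta>"
proof -
  let ?A = "Poly_Mapping.keys \<alpha> \<union> Poly_Mapping.keys \<beta>"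
  have "Poly_Mapping.keys (\<alpha> + \<beta>) \<subseteq> ?A" by (rule keys_add)
  then show ?thesis
    by (simp add: mdeg_superset[of ?A] lookup_add sum.distrib)
qed

lemma mdeg_eq_0_iff [simp]: "mdeg \<alpha> = 0 \<longleftrightarrow> \<alpha> = 0"
  by (auto simp: mdeg_def in_keys_iff intro!: poly_mapping_eqI)

lemma lookup_le_mdeg: "Poly_Mapping.lookup \<alpha> i \<le> mdeg \<alpha>"
proof (cases "i \<in> Poly_Mapping.keys \<alpha>")
  case True
  then show ?thesis unfolding mdeg_def by (intro member_le_sum) auto
qed (simp add: in_keys_iff)

lemma in_vars_0 [simp]: "in_vars n 0"
  by (simp add: in_vars_def)

lemma in_vars_add [simp]: "in_vars n (\<alpha> + \<beta> :: mon) \<longleftrightarrow> in_vars n \<alpha> \<and> in_vars n \<beta>"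
proof -
  have "Poly_Mapping.keys (\<alpha> + \<beta>) = Poly_Mapping.keys \<alpha> \<union> Poly_Mapping.keys \<beta>"
    by (auto simp: in_keys_iff lookup_add)
  then show ?thesis by (simp add: in_vars_def)
qed

lemma in_vars_mono: "in_vars m \<alpha> \<Longrightarrow> m \<le> n \<Longrightarrow> in_vars n \<alpha>"
  unfolding in_vars_def by fastforce

lemma in_vars_lookup: "in_vars n \<alpha> \<Longrightarrow> i \<notin> {1..n} \<Longrightarrow> Poly_Mapping.lookup \<alpha> i = 0"
  unfolding in_vars_def by (meson in_keys_iff subsetD)

lemma in_vars_SucD:
  assumes "in_vars (Suc m) \<alpha>" "Poly_Mapping.lookup \<alpha> (Suc m) = 0"
  shows "in_vars m \<alpha>"
proof -
  have "Suc m \<notin> Poly_Mapping.keys \<alpha>" using assms(2) by (simp add: in_keys_iff)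
  moreover have "Poly_Mapping.keys \<alpha> \<subseteq> insert (Suc m) {1..m}"
    using assms(1) by (simp add: in_vars_def atLeastAtMostSuc_conv)
  ultimately show ?thesis unfolding in_vars_def by blast
qed

lemma single_add_diff:
  fixes \<alpha> :: mon
  assumes "Poly_Mapping.lookup \<alpha> i \<noteq> 0"
  shows "Poly_Mapping.single i 1 + (\<alpha> - Poly_Mapping.single i 1) = \<alpha>"
  by (rule poly_mapping_eqI) (use assms in \<open>auto simp: lookup_add lookup_minus lookup_single when_def\<close>)

lemma monomials_in_vars_0: "{\<alpha>. in_vars 0 \<alpha> \<and> mdeg \<alpha> = d} = (if d = 0 then {0} else {})"
  by (auto simp: in_vars_def)

text \<open>The split by divisibility by x_{m+1}, which mirrors \<open>hsym_insert\<close>.\<close>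

lemma monomials_Suc_Suc:
  "{\<alpha>. in_vars (Suc m) \<alpha> \<and> mdeg \<alpha> = Suc d} =
     {\<alpha>. in_vars m \<alpha> \<and> mdeg \<alpha> = Suc d} \<union>
     (+) (Poly_Mapping.single (Suc m) 1) ` {\<alpha>. in_vars (Suc m) \<alpha> \<and> mdeg \<alpha> = d}" (is "?L = ?A \<union> ?B")
proof
  show "?A \<union> ?B \<subseteq> ?L"
    by (auto simp: mdeg_add elim: in_vars_mono) (auto simp: in_vars_def)
  show "?L \<subseteq> ?A \<union> ?B"
  proof
    fix \<alpha> assume \<alpha>: "\<alpha> \<in> ?L"
    show "\<alpha> \<in> ?A \<union> ?B"
    proof (cases "Poly_Mapping.lookup \<alpha> (Suc m) = 0")
      case True
      then have "in_vars m \<alpha>"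
        using \<alpha> by (simp add: in_vars_SucD)
      with \<alpha> show ?thesis by simp
    next
      case False
      define \<beta> where "\<beta> = \<alpha> - Poly_Mapping.single (Suc m) 1"
      have eq: "\<alpha> = Poly_Mapping.single (Suc m) 1 + \<beta>"
        unfolding \<beta>_def using single_add_diff[OF False] by simp
      have "in_vars (Suc m) \<beta>" "mdeg \<beta> = d"
        using \<alpha> unfolding eq by (auto simp: mdeg_add)
      with eq show ?thesis by auto
    qed
  qed
qed

lemma finite_monomials: "finite {\<alpha>. in_vars m \<alpha> \<and> mdeg \<alpha> = d}"
proof (induction m arbitrary: d)
  case 0
  then show ?case by (simp add: monomials_in_vars_0)
next
  case (Suc m)
  show ?case
  proof (induction d)
    case (Suc d)
    then show ?case using \<open>\<And>d. finite {\<alpha>. in_vars m \<alpha> \<and> mdeg \<alpha> = d}\<close>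
      unfolding monomials_Suc_Suc by blast
  qed (simp cong: conj_cong)
qed

definition meval :: "nat \<Rightarrow> (nat \<Rightarrow> 'b::comm_ring_1) \<Rightarrow> mon \<Rightarrow> 'b" where
  "meval n x \<alpha> = (\<Prod>i\<in>{1..n}. x i ^ Poly_Mapping.lookup \<alpha> i)"

lemma meval_0 [simp]: "meval n x 0 = 1"
  by (simp add: meval_def)

lemma meval_add: "meval n x (\<alpha> + \<beta>) = meval n x \<alpha> * meval n x \<beta>"
  by (simp add: meval_def lookup_add power_add prod.distrib)

lemma meval_single:
  assumes "i \<in> {1..n}"
  shows "meval n x (Poly_Mapping.single i c) = x i ^ c"
proof -
  have "meval n x (Poly_Mapping.single i c) = (\<Prod>j\<in>{1..n}. if j = i then x j ^ c else 1)"
    unfolding meval_def by (rule prod.cong) (auto simp: lookup_single when_def)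
  then show ?thesis using assms by simp
qed

lemma meval_mono:
  assumes "in_vars m \<alpha>" "m \<le> n"
  shows "meval m x \<alpha> = meval n x \<alpha>"
  unfolding meval_def using assms
  by (intro prod.mono_neutral_left) (auto simp: in_vars_lookup[OF assms(1)])

text \<open>Bridge between definitions by monomials and generating series. At \<open>var\<close> it
  identifies \<open>h_poly\<close>; at a point it turns sums of moments into values of h_d.\<close>

lemma sum_meval_eq_hsym:
  "(\<Sum>\<alpha> | in_vars m \<alpha> \<and> mdeg \<alpha> = d. meval m x \<alpha>) = hsym x {1..m} d"
proof (induction m arbitrary: d)
  case 0
  show ?case unfolding monomials_in_vars_0 by (cases d) simp_all
next
  case (Suc m)
  show ?case
  proof (induction d)
    case 0
    have "{\<alpha>. in_vars (Suc m) \<alpha> \<and> mdeg \<alpha> = 0} = {0}" by auto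
    then show ?case by simp
  next
    case (Suc d)
    let ?f = "(+) (Poly_Mapping.single (Suc m) 1) :: mon \<Rightarrow> mon"
    have "Poly_Mapping.lookup (?f \<alpha>) (Suc m) \<noteq> 0" for \<alpha>
      by (simp add: lookup_add)
    then have disj: "{\<alpha>. in_vars m \<alpha> \<and> mdeg \<alpha> = Suc d} \<inter> ?f ` {\<alpha>. in_vars (Suc m) \<alpha> \<and> mdeg \<alpha> = d} = {}"
      using in_vars_lookup[of m _ "Suc m"] by fastforce
    have "(\<Sum>\<alpha> | in_vars (Suc m) \<alpha> \<and> mdeg \<alpha> = Suc d. meval (Suc m) x \<alpha>) =
       (\<Sum>\<alpha> | in_vars m \<alpha> \<and> mdeg \<alpha> = Suc d. meval (Suc m) x \<alpha>) +
       (\<Sum>\<alpha>\<in>?f ` {\<alpha>. in_vars (Suc m) \<alpha> \<and> mdeg \<alpha> = d}. meval (Suc m) x \<alpha>)"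
      unfolding monomials_Suc_Suc using disj finite_monomials by (intro sum.union_disjoint) auto
    also have "(\<Sum>\<alpha> | in_vars m \<alpha> \<and> mdeg \<alpha> = Suc d. meval (Suc m) x \<alpha>) = hsym x {1..m} (Suc d)"
      unfolding \<open>\<And>d. _ = hsym x {1..m} d\<close>[symmetric]
      by (intro sum.cong) (auto simp: meval_mono[of m _ "Suc m"])
    also have "(\<Sum>\<alpha>\<in>?f ` {\<alpha>. in_vars (Suc m) \<alpha> \<and> mdeg \<alpha> = d}. meval (Suc m) x \<alpha>) =
       x (Suc m) * hsym x {1..Suc m} d"
      unfolding Suc[symmetric] sum_distrib_left
      by (subst sum.reindex) (auto simp: meval_add meval_single intro!: sum.cong)
    also have "hsym x {1..m} (Suc d) + x (Suc m) * hsym x {1..Suc m} d = hsym x {1..Suc m} (Suc d)"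
      using hsym_insert[of "{1..m}" "Suc m" x d] by (simp add: atLeastAtMostSuc_conv)
    finally show ?case .
  qed
qed

abbreviation sqfree_mon :: "mon \<Rightarrow> bool" where
  "sqfree_mon \<alpha> \<equiv> (\<forall>i. Poly_Mapping.lookup \<alpha> i \<le> 1)"

lemma sqfree_monomials_Suc_Suc:
  "{\<alpha>. in_vars (Suc m) \<alpha> \<and> mdeg \<alpha> = Suc d \<and> sqfree_mon \<alpha>} =
     {\<alpha>. in_vars m \<alpha> \<and> mdeg \<alpha> = Suc d \<and> sqfree_mon \<alpha>} \<union>
     (+) (Poly_Mapping.single (Suc m) 1) ` {\<alpha>. in_vars m \<alpha> \<and> mdeg \<alpha> = d \<and> sqfree_mon \<alpha>}" (is "?L = ?A \<union> ?B")
proof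
  have "sqfree_mon (Poly_Mapping.single (Suc m) 1 + \<alpha>)" if "in_vars m \<alpha>" "sqfree_mon \<alpha>" for \<alpha>
    using that(2) in_vars_lookup[OF that(1), of "Suc m"] 
    by (auto simp: lookup_add lookup_single when_def)
  then show "?A \<union> ?B \<subseteq> ?L"
    by (auto simp: mdeg_add elim: in_vars_mono) (auto simp: in_vars_def)
  show "?L \<subseteq> ?A \<union> ?B"
  proof
    fix \<alpha> assume \<alpha>: "\<alpha> \<in> ?L"
    show "\<alpha> \<in> ?A \<union> ?B"
    proof (cases "Poly_Mapping.lookup \<alpha> (Suc m) = 0")
      case True
      then have "in_vars m \<alpha>"
        using \<alpha> by (simp add: in_vars_SucD)
      with \<alpha> show ?thesis by simp
    next
      case False
      define \<beta> where "\<beta> = \<alpha> - Poly_Mapping.single (Suc m) 1"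
      have eq: "\<alpha> = Poly_Mapping.single (Suc m) 1 + \<beta>"
        unfolding \<beta>_def using single_add_diff[OF False] by simp
      have "Poly_Mapping.lookup \<alpha> (Suc m) \<le> 1" using \<alpha> by blast
      then have 0: "Poly_Mapping.lookup \<beta> (Suc m) = 0" unfolding eq by (simp add: lookup_add)
      have \<beta>: "in_vars (Suc m) \<beta>" "mdeg \<beta> = d"
        using \<alpha> unfolding eq by (auto simp: mdeg_add)
      have "in_vars m \<beta>"
        using \<beta>(1) 0 by (rule in_vars_SucD)
      moreover have "Poly_Mapping.lookup \<beta> i \<le> Poly_Mapping.lookup \<alpha> i" for i
        unfolding eq by (simp add: lookup_add)
      then have "sqfree_mon \<beta>" using \<alpha> by (blast intro: le_trans)
      ultimately show ?thesis using eq \<beta> by auto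
    qed
  qed
qed

lemma sum_sqfree_meval_eq_esym:
  "(\<Sum>\<alpha> | in_vars m \<alpha> \<and> mdeg \<alpha> = d \<and> sqfree_mon \<alpha>. meval m x \<alpha>) = (-1) ^ d * esym x {1..m} d"
proof (induction m arbitrary: d)
  case 0
  have "{\<alpha>. in_vars 0 \<alpha> \<and> mdeg \<alpha> = d \<and> sqfree_mon \<alpha>} = (if d = 0 then {0} else {})"
    by (auto simp: in_vars_def)
  then show ?case using esym_eq_0[of "{}::nat set" d x] by (cases d) (simp_all only: sum.empty, simp_all)
next
  case (Suc m)
  show ?case
  proof (cases d)
    case 0
    have "{\<alpha>. in_vars (Suc m) \<alpha> \<and> mdeg \<alpha> = 0 \<and> sqfree_mon \<alpha>} = {0}" by auto
    then show ?thesis using 0 by simp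
  next
    case (Suc d')
    let ?f = "(+) (Poly_Mapping.single (Suc m) 1) :: mon \<Rightarrow> mon"
    let ?A = "\<lambda>d. {\<alpha>. in_vars m \<alpha> \<and> mdeg \<alpha> = d \<and> sqfree_mon \<alpha>}"
    have fin: "finite (?A d)" for d
      by (rule finite_subset[OF _ finite_monomials[of m d]]) auto
    have "Poly_Mapping.lookup (?f \<alpha>) (Suc m) \<noteq> 0" for \<alpha>
      by (simp add: lookup_add)
    then have disj: "?A (Suc d') \<inter> ?f ` ?A d' = {}"
      using in_vars_lookup[of m _ "Suc m"] by fastforce
    have "(\<Sum>\<alpha> | in_vars (Suc m) \<alpha> \<and> mdeg \<alpha> = Suc d' \<and> sqfree_mon \<alpha>. meval (Suc m) x \<alpha>) =
       (\<Sum>\<alpha>\<in>?A (Suc d'). meval (Suc m) x \<alpha>) + (\<Sum>\<alpha>\<in>?f ` ?A d'. meval (Suc m) x \<alpha>)"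
      unfolding sqfree_monomials_Suc_Suc using disj fin by (intro sum.union_disjoint) auto
    also have "(\<Sum>\<alpha>\<in>?A (Suc d'). meval (Suc m) x \<alpha>) = (-1) ^ Suc d' * esym x {1..m} (Suc d')"
      unfolding Suc.IH[symmetric]
      by (intro sum.cong) (auto simp: meval_mono[of m _ "Suc m"])
    also have "(\<Sum>\<alpha>\<in>?f ` ?A d'. meval (Suc m) x \<alpha>) = x (Suc m) * ((-1) ^ d' * esym x {1..m} d')"
      unfolding Suc.IH[symmetric] sum_distrib_left
      by (subst sum.reindex) (auto simp: meval_add meval_single meval_mono[of m _ "Suc m"] intro!: sum.cong)
    also have "(-1) ^ Suc d' * esym x {1..m} (Suc d') + x (Suc m) * ((-1) ^ d' * esym x {1..m} d')
        = (-1) ^ Suc d' * esym x {1..Suc m} (Suc d')"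
      by (simp add: atLeastAtMostSuc_conv esym_insert algebra_simps)
    finally show ?thesis using Suc by simp
  qed
qed

section \<open>Identification with the given polynomials h and e\<close>

lemma var_power: "var i ^ c = Poly_Mapping.single (Poly_Mapping.single i c) (1::'a::field)"
proof (induction c)
  case (Suc c)
  have "var i ^ Suc c = Poly_Mapping.single (Poly_Mapping.single i 1 + Poly_Mapping.single i c) (1::'a)"
    unfolding power_Suc Suc by (simp add: var_def mult_single)
  then show ?case by (simp add: single_add[symmetric])
qed simp

lemma prod_single:
  "(\<Prod>i\<in>A. Poly_Mapping.single (f i) (1::'a::field)) = Poly_Mapping.single (\<Sum>i\<in>A. (f i :: mon)) 1"
  by (induction A rule: infinite_finite_induct) (simp_all add: mult_single)

lemma sum_singles_lookup:
  assumes "in_vars n \<alpha>"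
  shows "(\<Sum>i\<in>{1..n}. Poly_Mapping.single i (Poly_Mapping.lookup \<alpha> i)) = \<alpha>"
proof (rule poly_mapping_eqI)
  fix j
  have "(\<Sum>i\<in>{1..n}. Poly_Mapping.lookup \<alpha> i when i = j) = Poly_Mapping.lookup \<alpha> j"
    using in_vars_lookup[OF assms, of j] by (cases "j \<in> {1..n}") (auto simp: when_def)
  then show "Poly_Mapping.lookup (\<Sum>i\<in>{1..n}. Poly_Mapping.single i (Poly_Mapping.lookup \<alpha> i)) j =
      Poly_Mapping.lookup \<alpha> j"
    by (simp add: lookup_sum lookup_single)
qed

lemma meval_var: "in_vars n \<alpha> \<Longrightarrow> meval n var \<alpha> = Poly_Mapping.single \<alpha> (1::'a::field)"
  by (simp only: meval_def var_power prod_single sum_singles_lookup)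

lemma h_poly_eq_hsym: "h_poly d m = hsym var {1..m} d"
  unfolding h_poly_def sum_meval_eq_hsym[symmetric] by (rule sum.cong) (auto simp: meval_var)

lemma e_poly_eq_esym: "e_poly d m = (-1) ^ d * esym var {1..m} d"
  unfolding e_poly_def sum_sqfree_meval_eq_esym[symmetric] by (rule sum.cong) (auto simp: meval_var)

section \<open>Leading monomials\<close>

definition neglex_less :: "mon \<Rightarrow> mon \<Rightarrow> bool" where
  "neglex_less \<alpha> \<beta> \<longleftrightarrow> (\<exists>i. Poly_Mapping.lookup \<alpha> i < Poly_Mapping.lookup \<beta> i \<and>
     (\<forall>j>i. Poly_Mapping.lookup \<alpha> j = Poly_Mapping.lookup \<beta> j))"

lemma neglex_le_iff: "neglex_le \<alpha> \<beta> \<longleftrightarrow> \<alpha> = \<beta> \<or> neglex_less \<alpha> \<beta>"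
  by (auto simp: neglex_le_def neglex_less_def)

lemma neglex_less_irrefl [simp]: "\<not> neglex_less \<alpha> \<alpha>"
  by (simp add: neglex_less_def)

lemma neglex_less_trans:
  assumes "neglex_less \<alpha> \<beta>" "neglex_less \<beta> \<gamma>"
  shows "neglex_less \<alpha> \<gamma>"
proof -
  obtain i where i: "Poly_Mapping.lookup \<alpha> i < Poly_Mapping.lookup \<beta> i"
      "\<forall>j>i. Poly_Mapping.lookup \<alpha> j = Poly_Mapping.lookup \<beta> j"
    using assms(1) by (auto simp: neglex_less_def)
  obtain i' where i': "Poly_Mapping.lookup \<beta> i' < Poly_Mapping.lookup \<gamma> i'"
      "\<forall>j>i'. Poly_Mapping.lookup \<beta> j = Poly_Mapping.lookup \<gamma> j"
    using assms(2) by (auto simp: neglex_less_def)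
  have "Poly_Mapping.lookup \<alpha> (max i i') < Poly_Mapping.lookup \<gamma> (max i i')"
    using i i' by (cases i i' rule: linorder_cases) (auto simp: max_def)
  then show ?thesis unfolding neglex_less_def using i i' by (intro exI[of _ "max i i'"]) auto
qed

text \<open>The largest index at which the exponents differ decides; it exists because supports are
  finite.\<close>

lemma neglex_less_linear: "neglex_less \<alpha> \<beta> \<or> \<alpha> = \<beta> \<or> neglex_less \<beta> \<alpha>"
proof (cases "\<alpha> = \<beta>")
  case False
  let ?N = "{i. Poly_Mapping.lookup \<alpha> i \<noteq> Poly_Mapping.lookup \<beta> i}"
  have "?N \<subseteq> Poly_Mapping.keys \<alpha> \<union> Poly_Mapping.keys \<beta>"
    by (auto simp: in_keys_iff)
  then have fin: "finite ?N" by (rule finite_subset) simp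
  have ne: "?N \<noteq> {}" using False by (auto intro: poly_mapping_eqI)
  have "Max ?N \<in> ?N" using fin ne by (rule Max_in)
  moreover have "Poly_Mapping.lookup \<alpha> j = Poly_Mapping.lookup \<beta> j" if "j > Max ?N" for j
    using that fin Max_ge leD by blast
  ultimately show ?thesis unfolding neglex_less_def by (metis (mono_tags, lifting) linorder_neqE_nat mem_Collect_eq)
qed simp

lemma neglex_less_add_left: "neglex_less \<alpha> \<beta> \<Longrightarrow> neglex_less (\<gamma> + \<alpha>) (\<gamma> + \<beta>)"
  by (auto simp: neglex_less_def lookup_add)

lemma neglex_less_add_right: "neglex_less \<alpha> \<beta> \<Longrightarrow> neglex_less (\<alpha> + \<gamma>) (\<beta> + \<gamma>)"
  by (auto simp: neglex_less_def lookup_add)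

lemma neglex_max_exists:
  assumes "finite A" "A \<noteq> {}"
  shows "\<exists>\<mu>\<in>A. \<forall>\<alpha>\<in>A. neglex_le \<alpha> \<mu>"
  using assms
proof (induction A rule: finite_ne_induct)
  case (singleton \<alpha>)
  then show ?case by (simp add: neglex_le_iff)
next
  case (insert \<alpha> A)
  then obtain \<mu> where \<mu>: "\<mu> \<in> A" "\<forall>\<beta>\<in>A. neglex_le \<beta> \<mu>" by auto
  show ?case
  proof (cases "neglex_less \<mu> \<alpha>")
    case True
    then show ?thesis using \<mu> by (auto simp: neglex_le_iff intro: neglex_less_trans)
  next
    case False
    then show ?thesis using \<mu> neglex_less_linear[of \<alpha> \<mu>] by (auto simp: neglex_le_iff)
  qed
qed

lemma lm_eqI:
  assumes "\<mu> \<in> Poly_Mapping.keys f" "\<And>\<alpha>. \<alpha> \<in> Poly_Mapping.keys f \<Longrightarrow> neglex_le \<alpha> \<mu>"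
  shows "lm f = \<mu>"
  unfolding lm_def
proof (rule the_equality)
  fix \<nu> assume \<nu>: "\<nu> \<in> Poly_Mapping.keys f \<and> (\<forall>\<alpha>\<in>Poly_Mapping.keys f. neglex_le \<alpha> \<nu>)"
  then have "neglex_le \<nu> \<mu>" "neglex_le \<mu> \<nu>" using assms by auto
  then show "\<nu> = \<mu>" using neglex_less_trans[of \<mu> \<nu> \<mu>] by (auto simp: neglex_le_iff)
qed (use assms in auto)

lemma lm_max:
  assumes "f \<noteq> 0"
  shows "lm f \<in> Poly_Mapping.keys f" "\<And>\<alpha>. \<alpha> \<in> Poly_Mapping.keys f \<Longrightarrow> neglex_le \<alpha> (lm f)"
proof -
  have "Poly_Mapping.keys f \<noteq> {}" using assms by (simp add: keys_eq_empty)
  then obtain \<mu> where "\<mu> \<in> Poly_Mapping.keys f" "\<forall>\<alpha>\<in>Poly_Mapping.keys f. neglex_le \<alpha> \<mu>"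
    using neglex_max_exists[of "Poly_Mapping.keys f"] by auto
  moreover from this have "lm f = \<mu>" by (intro lm_eqI) auto
  ultimately show "lm f \<in> Poly_Mapping.keys f" "\<And>\<alpha>. \<alpha> \<in> Poly_Mapping.keys f \<Longrightarrow> neglex_le \<alpha> (lm f)"
    by auto
qed

text \<open>Phrased through the difference so that it passes to products and to sums with smaller
  terms without computing \<open>lm\<close>. It yields leading monomial, leading coefficient 1 and
  nonvanishing at once.\<close>

definition monic_lead :: "('a::field) mpoly \<Rightarrow> mon \<Rightarrow> bool" where
  "monic_lead f \<mu> \<longleftrightarrow> (\<forall>\<alpha>\<in>Poly_Mapping.keys (f - Poly_Mapping.single \<mu> 1). neglex_less \<alpha> \<mu>)"

lemma monic_lead_props:
  assumes "monic_lead f \<mu>"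
  shows "f \<noteq> 0" "lm f = \<mu>" "lc f = 1"
proof -
  have "\<mu> \<notin> Poly_Mapping.keys (f - Poly_Mapping.single \<mu> 1)"
    using assms unfolding monic_lead_def by (metis neglex_less_irrefl)
  then have 1: "Poly_Mapping.lookup f \<mu> = 1"
    by (simp add: in_keys_iff lookup_minus)
  then show "f \<noteq> 0" by auto
  have "\<mu> \<in> Poly_Mapping.keys f" using 1 by (simp add: in_keys_iff)
  moreover have "neglex_le \<alpha> \<mu>" if "\<alpha> \<in> Poly_Mapping.keys f" for \<alpha>
  proof (cases "\<alpha> = \<mu>")
    case False
    then have "\<alpha> \<in> Poly_Mapping.keys (f - Poly_Mapping.single \<mu> 1)"
      using that by (simp add: in_keys_iff lookup_minus lookup_single)
    then show ?thesis using assms by (simp add: monic_lead_def neglex_le_iff)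
  qed (simp add: neglex_le_iff)
  ultimately show "lm f = \<mu>" by (rule lm_eqI)
  then show "lc f = 1" using 1 by (simp add: lc_def)
qed

lemma monic_lead_mult:
  assumes "monic_lead f \<mu>" "monic_lead g \<nu>"
  shows "monic_lead (f * g) (\<mu> + \<nu>)"
proof -
  let ?s = "Poly_Mapping.single \<mu> (1::'a)" and ?t = "Poly_Mapping.single \<nu> (1::'a)"
  let ?f = "f - ?s" and ?g = "g - ?t"
  have st: "Poly_Mapping.single (\<mu> + \<nu>) (1::'a) = ?s * ?t" by (simp add: mult_single)
  \<comment> \<open>Every summand contains the lower part of at least one factor, which pushes its
    monomials below \<mu> + \<nu>.\<close>
  have "f * g - Poly_Mapping.single (\<mu> + \<nu>) 1 = ?f * ?g + (?f * ?t + ?s * ?g)"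
    unfolding st by (simp add: algebra_simps)
  then have "Poly_Mapping.keys (f * g - Poly_Mapping.single (\<mu> + \<nu>) 1) \<subseteq>
      Poly_Mapping.keys (?f * ?g) \<union> (Poly_Mapping.keys (?f * ?t) \<union> Poly_Mapping.keys (?s * ?g))"
    using keys_add[of "?f * ?g" "?f * ?t + ?s * ?g"] keys_add[of "?f * ?t" "?s * ?g"] by auto
  moreover have "neglex_less \<alpha> (\<mu> + \<nu>)" if \<alpha>: "\<alpha> \<in> Poly_Mapping.keys (?f * ?g)" for \<alpha>
  proof -
    obtain a b where "\<alpha> = a + b" "a \<in> Poly_Mapping.keys ?f" "b \<in> Poly_Mapping.keys ?g"
      using keys_mult[of ?f ?g] \<alpha> by auto
    then show ?thesis using assms unfolding monic_lead_def
      by (metis neglex_less_trans neglex_less_add_left neglex_less_add_right)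
  qed
  moreover have "neglex_less \<alpha> (\<mu> + \<nu>)" if \<alpha>: "\<alpha> \<in> Poly_Mapping.keys (?f * ?t)" for \<alpha>
  proof -
    obtain a where "\<alpha> = a + \<nu>" "a \<in> Poly_Mapping.keys ?f"
      using keys_mult[of ?f ?t] \<alpha> by auto
    then show ?thesis using assms unfolding monic_lead_def
      by (metis neglex_less_add_right)
  qed
  moreover have "neglex_less \<alpha> (\<mu> + \<nu>)" if \<alpha>: "\<alpha> \<in> Poly_Mapping.keys (?s * ?g)" for \<alpha>
  proof -
    obtain a where "\<alpha> = \<mu> + a" "a \<in> Poly_Mapping.keys ?g"
      using keys_mult[of ?s ?g] \<alpha> by auto
    then show ?thesis using assms unfolding monic_lead_def
      by (metis neglex_less_add_left)
  qed
  ultimately show ?thesis unfolding monic_lead_def by blast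
qed

lemma monic_lead_1 [simp]: "monic_lead 1 0"
  by (simp add: monic_lead_def)

lemma monic_lead_prod:
  assumes "\<And>i. i \<in> A \<Longrightarrow> monic_lead (f i) (\<mu> i)"
  shows "monic_lead (\<Prod>i\<in>A. f i) (\<Sum>i\<in>A. \<mu> i)"
  using assms by (induction A rule: infinite_finite_induct) (auto intro: monic_lead_mult)

lemma monic_lead_keys:
  assumes "monic_lead f \<mu>" "\<alpha> \<in> Poly_Mapping.keys f"
  shows "neglex_le \<alpha> \<mu>"
  using lm_max(2)[of f \<alpha>] monic_lead_props[OF assms(1)] assms(2) by simp

lemma monic_lead_add:
  assumes "monic_lead f \<mu>" "\<And>\<alpha>. \<alpha> \<in> Poly_Mapping.keys g \<Longrightarrow> neglex_less \<alpha> \<mu>"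
  shows "monic_lead (f + g) \<mu>"
proof -
  have "f + g - Poly_Mapping.single \<mu> 1 = (f - Poly_Mapping.single \<mu> 1) + g" by (simp only: diff_add_eq)
  then have "Poly_Mapping.keys (f + g - Poly_Mapping.single \<mu> 1) \<subseteq>
     Poly_Mapping.keys (f - Poly_Mapping.single \<mu> 1) \<union> Poly_Mapping.keys g"
    using keys_add[of "f - Poly_Mapping.single \<mu> 1" g] by (simp only:)
  then show ?thesis using assms unfolding monic_lead_def by blast
qed

lemma keys_sum_subset: "Poly_Mapping.keys (sum f A) \<subseteq> (\<Union>i\<in>A. Poly_Mapping.keys (f i))"
proof (induction A rule: infinite_finite_induct)
  case (insert a A)
  then show ?case using keys_add[of "f a" "sum f A"] by auto
qed auto

text \<open>x_p is the largest variable involved, and x_p^d is the only monomial of degree d whose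
  exponent at x_p is d.\<close>

lemma monic_lead_hsym:
  assumes "1 \<le> p"
  shows "monic_lead (hsym var {1..p} d :: ('a::field) mpoly) (Poly_Mapping.single p d)"
proof -
  let ?\<mu> = "Poly_Mapping.single p d"
  let ?A = "{\<alpha>. in_vars p \<alpha> \<and> mdeg \<alpha> = d}"
  have in_A: "?\<mu> \<in> ?A" using assms by (simp add: in_vars_def)
  have "hsym var {1..p} d - Poly_Mapping.single ?\<mu> 1 =
      (\<Sum>\<alpha>\<in>?A - {?\<mu>}. Poly_Mapping.single \<alpha> (1::'a))"
    unfolding h_poly_eq_hsym[symmetric] h_poly_def
    using in_A finite_monomials[of p d] by (subst sum.remove[of _ ?\<mu>]) auto
  moreover have "neglex_less \<alpha> ?\<mu>" if \<alpha>: "\<alpha> \<in> ?A - {?\<mu>}" for \<alpha>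
  proof -
    have "Poly_Mapping.lookup \<alpha> p \<noteq> d"
    proof
      assume d: "Poly_Mapping.lookup \<alpha> p = d"
      have "(\<Sum>i\<in>{1..p}. Poly_Mapping.lookup \<alpha> i) = d"
        using mdeg_superset[of "{1..p}" \<alpha>] \<alpha> by (simp add: in_vars_def)
      then have "(\<Sum>i\<in>{1..p} - {p}. Poly_Mapping.lookup \<alpha> i) = 0"
        using d assms sum.remove[of "{1..p}" p "Poly_Mapping.lookup \<alpha>"] by simp
      then have "Poly_Mapping.lookup \<alpha> i = 0" if "i \<noteq> p" for i
        using that in_vars_lookup[of p \<alpha> i] \<alpha> by (cases "i \<in> {1..p}") auto
      then have "\<alpha> = ?\<mu>" using d by (intro poly_mapping_eqI) (auto simp: lookup_single when_def)
      with \<alpha> show False by simp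
    qed
    moreover have "Poly_Mapping.lookup \<alpha> p \<le> d" using \<alpha> lookup_le_mdeg by auto
    ultimately show ?thesis using \<alpha> in_vars_lookup[of p \<alpha>]
      unfolding neglex_less_def by (intro exI[of _ p]) (auto simp: lookup_single)
  qed
  ultimately show ?thesis unfolding monic_lead_def
    using keys_sum_subset[of "\<lambda>\<alpha>. Poly_Mapping.single \<alpha> (1::'a)" "?A - {?\<mu>}"] by auto
qed

section \<open>Demazure operators and flagged Schur polynomials\<close>

lemma swap_idx_involution [simp]: "swap_idx i (swap_idx i j) = j"
  by (simp add: swap_idx_def)

lemma lookup_swap_mon: "Poly_Mapping.lookup (swap_mon i \<alpha>) j = Poly_Mapping.lookup \<alpha> (swap_idx i j)"
proof -
  have "swap_idx i l = j \<longleftrightarrow> l = swap_idx i j" for l by auto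
  then show ?thesis
    by (simp add: swap_mon_def lookup_sum lookup_single when_def in_keys_iff)
qed

lemma swap_mon_involution [simp]: "swap_mon i (swap_mon i \<alpha>) = \<alpha>"
  by (rule poly_mapping_eqI) (simp add: lookup_swap_mon)

lemma swap_mon_add: "swap_mon i (\<alpha> + \<beta>) = swap_mon i \<alpha> + swap_mon i \<beta>"
  by (rule poly_mapping_eqI) (simp add: lookup_swap_mon lookup_add)

lemma lookup_swap_poly: "Poly_Mapping.lookup (swap_poly i f) \<alpha> = Poly_Mapping.lookup f (swap_mon i \<alpha>)"
proof -
  have "swap_mon i \<beta> = \<alpha> \<longleftrightarrow> \<beta> = swap_mon i \<alpha>" for \<beta> by auto
  then show ?thesis
    by (simp add: swap_poly_def lookup_sum lookup_single when_def in_keys_iff)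
qed

lemma poly_mapping_sum_singles:
  "(\<Sum>\<alpha>\<in>Poly_Mapping.keys f. Poly_Mapping.single \<alpha> (Poly_Mapping.lookup f \<alpha>)) = f"
  by (rule poly_mapping_eqI) (auto simp: lookup_sum lookup_single when_def in_keys_iff)

lemma swap_poly_add: "swap_poly i (f + g) = swap_poly i f + swap_poly i g"
  by (rule poly_mapping_eqI) (simp add: lookup_swap_poly lookup_add)

lemma swap_poly_0 [simp]: "swap_poly i 0 = 0"
  by (simp add: swap_poly_def)

lemma swap_poly_sum: "swap_poly i (sum f A) = (\<Sum>a\<in>A. swap_poly i (f a))"
  by (induction A rule: infinite_finite_induct) (simp_all add: swap_poly_add)

lemma swap_poly_single: "swap_poly i (Poly_Mapping.single \<alpha> c) = Poly_Mapping.single (swap_mon i \<alpha>) c"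
  by (cases "c = 0") (simp_all add: swap_poly_def)

lemma swap_poly_mult: "swap_poly i (f * g) = swap_poly i f * swap_poly i g"
proof -
  have "f * g = (\<Sum>\<alpha>\<in>Poly_Mapping.keys f. \<Sum>\<beta>\<in>Poly_Mapping.keys g.
      Poly_Mapping.single (\<alpha> + \<beta>) (Poly_Mapping.lookup f \<alpha> * Poly_Mapping.lookup g \<beta>))"
    by (simp add: sum_product[symmetric] mult_single[symmetric] poly_mapping_sum_singles)
  then have "swap_poly i (f * g) = (\<Sum>\<alpha>\<in>Poly_Mapping.keys f. \<Sum>\<beta>\<in>Poly_Mapping.keys g.
      Poly_Mapping.single (swap_mon i \<alpha> + swap_mon i \<beta>) (Poly_Mapping.lookup f \<alpha> * Poly_Mapping.lookup g \<beta>))"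
    by (simp add: swap_poly_sum swap_poly_single swap_mon_add)
  also have "\<dots> = swap_poly i f * swap_poly i g"
    unfolding swap_poly_def sum_product mult_single ..
  finally show ?thesis .
qed

lemma swap_mon_single: "swap_mon i (Poly_Mapping.single j c) = Poly_Mapping.single (swap_idx i j) c"
  by (cases "c = 0") (simp_all add: swap_mon_def)

lemma swap_poly_1 [simp]: "swap_poly i 1 = 1"
  using swap_poly_single[of i 0 1] by (simp add: swap_mon_def)

text \<open>As a ring homomorphism, s_i can be moved inside determinants and inside
  \<open>hsym\<close>.\<close>

interpretation swap_poly: comm_ring_hom "swap_poly i"
  by unfold_locales (simp_all add: swap_poly_add swap_poly_mult)

lemma swap_poly_var [simp]: "swap_poly i (var j) = var (swap_idx i j)"
  by (simp add: var_def swap_poly_single swap_mon_single)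

lemma (in comm_ring_hom) hom_hsym: "finite A \<Longrightarrow> hom (hsym x A d) = hsym (\<lambda>i. hom (x i)) A d"
proof (induction A arbitrary: d rule: finite_induct)
  case empty
  then show ?case by (cases d) simp_all
next
  case (insert a A)
  show ?case
  proof (induction d)
    case (Suc d)
    then show ?case using insert by (simp add: hsym_insert hom_distribs)
  qed (simp add: insert)
qed

lemma swap_poly_hsym:
  "finite A \<Longrightarrow> swap_poly i (hsym var A d) = hsym (var :: nat \<Rightarrow> ('a::field) mpoly) (swap_idx i ` A) d"
  using hsym_reindex[of "swap_idx i" A "var :: nat \<Rightarrow> 'a mpoly"] inj_on_inverseI[of A "swap_idx i" "swap_idx i"]
  by (simp add: swap_poly.hom_hsym)

text \<open>The quotient is unique because polynomials form an integral domain and x_i - x_{i+1} is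
  nonzero; so exhibiting one quotient suffices.\<close>

lemma demazure_op_eqI:
  assumes "(var i - var (i + 1)) * g = var i * f - var (i + 1) * swap_poly i f"
  shows "demazure_op i f = (g :: ('a::field) mpoly)"
  unfolding demazure_op_def
proof (rule the_equality)
  fix g' :: "'a mpoly"
  assume "(var i - var (i + 1)) * g' = var i * f - var (i + 1) * swap_poly i f"
  then have "(var i - var (i + 1)) * g' = (var i - var (i + 1)) * g" using assms by simp
  moreover have "Poly_Mapping.lookup (var i) (Poly_Mapping.single i 1) \<noteq>
      Poly_Mapping.lookup (var (i + 1) :: 'a mpoly) (Poly_Mapping.single i 1)"
    by (simp add: var_def lookup_single poly_mapping_eq_iff fun_eq_iff when_def) (metis n_not_Suc_n)
  then have "var i - var (i + 1) \<noteq> (0 :: 'a mpoly)" by auto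
  ultimately show "g' = g" by simp
qed (rule assms)

text \<open>Expansion along row \<open>r\<close>: the three matrices share the cofactors of that
  row, so a linear relation between the rows passes to the determinants.\<close>

lemma det_row_combination:
  fixes f g h :: "nat \<times> nat \<Rightarrow> 'b::comm_ring_1"
  assumes "r < m"
    and "\<And>i j. i < m \<Longrightarrow> j < m \<Longrightarrow> i \<noteq> r \<Longrightarrow> f (i, j) = h (i, j) \<and> g (i, j) = h (i, j)"
    and "\<And>j. j < m \<Longrightarrow> c * h (r, j) = a * f (r, j) - b * g (r, j)"
  shows "c * det (mat m m h) = a * det (mat m m f) - b * det (mat m m g)"
proof -
  have f: "mat_delete (mat m m f) r j = mat_delete (mat m m h) r j" if "j < m" for j
    using that assms(1,2) by (intro eq_matI) (auto simp: mat_delete_def)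
  have g: "mat_delete (mat m m g) r j = mat_delete (mat m m h) r j" if "j < m" for j
    using that assms(1,2) by (intro eq_matI) (auto simp: mat_delete_def)
  have lap: "det (mat m m q) = (\<Sum>j<m. q (r, j) * cofactor (mat m m q) r j)" for q :: "nat \<times> nat \<Rightarrow> 'b"
    using laplace_expansion_row[of "mat m m q" m r] assms(1) by simp
  have "det (mat m m f) = (\<Sum>j<m. f (r, j) * cofactor (mat m m h) r j)"
    unfolding lap by (intro sum.cong) (auto simp: cofactor_def f)
  moreover have "det (mat m m g) = (\<Sum>j<m. g (r, j) * cofactor (mat m m h) r j)"
    unfolding lap by (intro sum.cong) (auto simp: cofactor_def g)
  moreover have "c * det (mat m m h) = (\<Sum>j<m. (a * f (r, j) - b * g (r, j)) * cofactor (mat m m h) r j)"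
    unfolding lap[of h] sum_distrib_left
    by (intro sum.cong) (simp_all add: assms(3)[symmetric] mult.assoc)
  ultimately show ?thesis
    by (simp add: sum_distrib_left sum_subtractf[symmetric] algebra_simps)
qed

text \<open>The guard gives 0 for a negative degree v_a - a + b, which truncated subtraction would
  turn into degree 0 and hence into the entry 1.\<close>

definition flag_entry :: "(nat \<Rightarrow> nat) \<Rightarrow> (nat \<Rightarrow> nat) \<Rightarrow> nat \<times> nat \<Rightarrow> ('a::field) mpoly" where
  "flag_entry p v = (\<lambda>(a, b). if a \<le> v a + b then hsym var {1..p a} (v a + b - a) else 0)"

definition flagged_schur :: "nat \<Rightarrow> (nat \<Rightarrow> nat) \<Rightarrow> (nat \<Rightarrow> nat) \<Rightarrow> ('a::field) mpoly" where
  "flagged_schur m p v = det (mat m m (flag_entry p v))"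

text \<open>With j = b - c, a column operation with coefficients from \<open>esym\<close> becomes a
  coefficient of a product of series, cut off at j = b. The two applications dispose of the missing
  terms in different ways.\<close>

lemma flag_row_convolution:
  "(\<Sum>c\<le>b. (if a \<le> w + c then hsym y A (w + c - a) else 0) * esym x B (b - c)) =
    (if a \<le> w + b then \<Sum>j\<in>{..w + b - a} \<inter> {..b}. esym x B j * hsym y A (w + b - a - j) else 0)"
  (is "?L = ?R")
proof (cases "a \<le> w + b")
  case True
  have "?L = (\<Sum>c\<in>{c. c \<le> b \<and> a \<le> w + c}. hsym y A (w + c - a) * esym x B (b - c))"
    by (rule sum.mono_neutral_cong_right) auto
  also have "\<dots> = (\<Sum>j\<in>{..w + b - a} \<inter> {..b}. esym x B j * hsym y A (w + b - a - j))"
    by (rule sum.reindex_bij_witness[of _ "\<lambda>j. b - j" "\<lambda>c. b - c"]) (use True in \<open>auto simp: mult.commute\<close>)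
  finally show ?thesis using True by simp
next
  case False
  then show ?thesis by (auto intro!: sum.neutral)
qed

lemma det_mat_mult_unitriangular:
  fixes f g :: "nat \<times> nat \<Rightarrow> 'b::comm_ring_1"
  assumes "\<And>c. c < m \<Longrightarrow> g (c, c) = 1" "\<And>b c. b < c \<Longrightarrow> c < m \<Longrightarrow> g (c, b) = 0"
  shows "det (mat m m f) = det (mat m m (\<lambda>(a, b). \<Sum>c\<le>b. f (a, c) * g (c, b)))"
proof -
  let ?U = "mat m m g"
  have "det ?U = prod_list (diag_mat ?U)"
    by (rule det_upper_triangular) (auto simp: upper_triangular_def assms(2))
  also have "diag_mat ?U = map (\<lambda>_. 1) [0..<m]"
    by (simp add: diag_mat_def assms(1))
  also have "prod_list \<dots> = (1::'b)" by (induction m) simp_all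
  finally have U: "det ?U = 1" .
  have "mat m m (\<lambda>(a, b). \<Sum>c\<le>b. f (a, c) * g (c, b)) = mat m m f * ?U"
  proof (rule eq_matI)
    fix a b assume "a < dim_row (mat m m f * ?U)" "b < dim_col (mat m m f * ?U)"
    then have ab: "a < m" "b < m" by auto
    have "(mat m m f * ?U) $$ (a, b) = (\<Sum>c\<in>{0..<m}. f (a, c) * g (c, b))"
      using ab by (simp add: scalar_prod_def)
    also have "\<dots> = (\<Sum>c\<le>b. f (a, c) * g (c, b))"
      using ab assms(2) by (intro sum.mono_neutral_right) auto
    finally show "mat m m (\<lambda>(a, b). \<Sum>c\<le>b. f (a, c) * g (c, b)) $$ (a, b) = (mat m m f * ?U) $$ (a, b)"
      using ab by simp
  qed auto
  then show ?thesis using det_mult[of "mat m m f" m ?U] U by simp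
qed

text \<open>Column operations with coefficients $\pm e_{b-c}(x_1,\dots,x_b)$, indexed from 0, make the matrix triangular.\<close>

lemma flagged_schur_initial:
  assumes p: "\<And>a. a < m \<Longrightarrow> p a = Suc a"
  shows "flagged_schur m p v = (\<Prod>a<m. var (Suc a) ^ v a)"
proof -
  define g :: "nat \<times> nat \<Rightarrow> 'a mpoly" where
    "g = (\<lambda>(c, b). if c \<le> b then esym var {1..b} (b - c) else 0)"
  define T :: "nat \<times> nat \<Rightarrow> 'a mpoly" where
    "T = (\<lambda>(a, b). \<Sum>c\<le>b. flag_entry p v (a, c) * g (c, b))"
  have T: "T (a, b) = (if a \<le> v a + b then
      fps_nth (egen var {1..b} * hgen var {1..p a}) (v a + b - a) else 0)" for a b
  proof -
    have "T (a, b) = (\<Sum>c\<le>b. (if a \<le> v a + c then hsym var {1..p a} (v a + c - a) else 0)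
        * esym var {1..b} (b - c))"
      unfolding T_def g_def flag_entry_def by (auto intro!: sum.cong)
    also have "\<dots> = (if a \<le> v a + b then \<Sum>j\<in>{..v a + b - a} \<inter> {..b}.
         esym var {1..b} j * hsym var {1..p a} (v a + b - a - j) else 0)"
      by (rule flag_row_convolution)
    \<comment> \<open>Here nothing is lost by the cut: e_j of b variables vanishes for j >
      b.\<close>
    also have "(\<Sum>j\<in>{..v a + b - a} \<inter> {..b}. esym var {1..b} j * hsym var {1..p a} (v a + b - a - j))
       = (\<Sum>j\<le>v a + b - a. esym var {1..b} j * hsym var {1..p a} (v a + b - a - j) :: 'a mpoly)"
      by (rule sum.mono_neutral_left) (auto simp: esym_eq_0)
    finally show ?thesis by (simp only: esym_hsym_convolution)
  qed
  \<comment> \<open>Only b - a - 1 factors survive the cancellation, fewer than the degree v_a + b -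
    a.\<close>
  have upper: "T (a, b) = 0" if "a < b" "b < m" for a b
  proof -
    have "egen var {1..b} * hgen var {1..p a} = (egen var ({1..b} - {1..p a}) :: 'a mpoly fps)"
      using that p[of a] by (intro egen_mult_hgen_subset) auto
    moreover have "card ({1..b} - {1..p a}) < v a + b - a"
      using that p[of a] by (subst card_Diff_subset) auto
    then have "esym var ({1..b} - {1..p a}) (v a + b - a) = (0 :: 'a mpoly)"
      by (intro esym_eq_0) auto
    ultimately show ?thesis unfolding T by (simp add: esym_def)
  qed
  \<comment> \<open>Only the inverse factor 1 / (1 - x_{a+1} t) survives, and its coefficients are
    powers of x_{a+1}.\<close>
  have diag: "T (a, a) = var (Suc a) ^ v a" if "a < m" for a
  proof -
    have "egen var {1..a} * hgen var {1..p a} = (hgen var ({1..p a} - {1..a}) :: 'a mpoly fps)"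
      using that p[of a] by (intro egen_mult_hgen_superset) auto
    moreover have "{1..p a} - {1..a} = {Suc a}" using that p by auto
    ultimately have "egen var {1..a} * hgen var {1..p a} = (hgen var {Suc a} :: 'a mpoly fps)" by simp
    then show ?thesis unfolding T using hsym_singleton[of var "Suc a" "v a"] by (simp add: hsym_def)
  qed
  have "flagged_schur m p v = det (mat m m T)"
    unfolding flagged_schur_def T_def by (rule det_mat_mult_unitriangular) (auto simp: g_def)
  also have "\<dots> = prod_list (diag_mat (mat m m T))"
    by (rule det_lower_triangular[of m]) (auto simp: upper)
  also have "diag_mat (mat m m T) = map (\<lambda>a. var (Suc a) ^ v a) [0..<m]"
    by (simp add: diag_mat_def diag)
  also have "prod_list \<dots> = (\<Prod>a<m. var (Suc a) ^ v a)"
    by (simp add: prod.list_conv_set_nth atLeast0LessThan)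
  finally show ?thesis .
qed

section \<open>Leading monomial of a flagged Schur polynomial\<close>

lemma lookup_sum_single:
  assumes "inj_on p A" "finite A"
  shows "a \<in> A \<Longrightarrow> Poly_Mapping.lookup (\<Sum>a\<in>A. Poly_Mapping.single (p a) (w a)) (p a) = w a"
    and "i \<notin> p ` A \<Longrightarrow> Poly_Mapping.lookup (\<Sum>a\<in>A. Poly_Mapping.single (p a) (w a)) i = 0"
proof -
  assume a: "a \<in> A"
  have "Poly_Mapping.lookup (\<Sum>a\<in>A. Poly_Mapping.single (p a) (w a)) (p a) =
      (\<Sum>b\<in>A. if b = a then w b else 0)"
    unfolding lookup_sum using assms a by (intro sum.cong) (auto simp: lookup_single when_def inj_on_def)
  then show "Poly_Mapping.lookup (\<Sum>a\<in>A. Poly_Mapping.single (p a) (w a)) (p a) = w a"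
    using a assms by simp
next
  assume "i \<notin> p ` A"
  then show "Poly_Mapping.lookup (\<Sum>a\<in>A. Poly_Mapping.single (p a) (w a)) i = 0"
    unfolding lookup_sum by (intro sum.neutral) (auto simp: lookup_single when_def)
qed

text \<open>The largest moved point cannot go up: its image would then be a fixed point, against
  injectivity.\<close>

lemma permutes_last_moved:
  fixes m :: nat
  assumes "\<sigma> permutes {0..<m}" "\<sigma> \<noteq> id"
  obtains a where "a < m" "\<sigma> a < a" "\<And>b. b > a \<Longrightarrow> \<sigma> b = b"
proof -
  let ?N = "{a. \<sigma> a \<noteq> a}"
  have N: "?N \<subseteq> {0..<m}" using assms(1) permutes_not_in by fastforce
  then have fin: "finite ?N" by (rule finite_subset) simp
  have "?N \<noteq> {}" using assms(2) by auto
  then have M: "Max ?N \<in> ?N" using fin by (rule Max_in[rotated])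
  have above: "\<sigma> b = b" if "b > Max ?N" for b
    using that fin Max_ge leD by blast
  have "\<not> \<sigma> (Max ?N) > Max ?N"
  proof
    assume "\<sigma> (Max ?N) > Max ?N"
    then have "\<sigma> (\<sigma> (Max ?N)) = \<sigma> (Max ?N)" by (rule above)
    then have "\<sigma> (Max ?N) = Max ?N" using permutes_inj[OF assms(1)] by (simp add: inj_eq)
    with M show False by simp
  qed
  then have "\<sigma> (Max ?N) < Max ?N" using M by (metis (mono_tags, lifting) linorder_neqE_nat mem_Collect_eq)
  moreover have "Max ?N < m" using M N by auto
  ultimately show ?thesis using that above by blast
qed

text \<open>The identity term has the claimed leading monomial. For any other permutation, let
  \<open>a\<close> be the last row it moves: the degree in row \<open>a\<close> drops and later rows
  keep theirs. As \<open>p\<close> increases, x_{p_a} is the largest variable whose exponent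
  changes.\<close>

lemma monic_lead_flagged_schur:
  assumes p: "strict_mono_on {..<m} p" "\<And>a. a < m \<Longrightarrow> 1 \<le> p a"
  shows "monic_lead (flagged_schur m p v :: ('a::field) mpoly) (\<Sum>a<m. Poly_Mapping.single (p a) (v a))"
proof -
  let ?\<mu> = "\<Sum>a<m. Poly_Mapping.single (p a) (v a)"
  let ?P = "{\<sigma>. \<sigma> permutes {0..<m}}"
  let ?t = "\<lambda>\<sigma>. signof \<sigma> * (\<Prod>a = 0..<m. flag_entry p v (a, \<sigma> a)) :: 'a mpoly"
  have "finite ?P" by (simp add: finite_permutations)
  moreover have "id \<in> ?P" by (simp add: permutes_id)
  moreover have "flagged_schur m p v = (\<Sum>\<sigma>\<in>?P. ?t \<sigma>)"
    unfolding flagged_schur_def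
    by (subst det_def'[of _ m]) (auto intro!: sum.cong arg_cong2[of _ _ _ _ "(*)"] prod.cong dest: permutes_in_image)
  ultimately have eq: "flagged_schur m p v = ?t id + (\<Sum>\<sigma>\<in>?P - {id}. ?t \<sigma>)"
    using sum.remove[of ?P id ?t] by (simp only:)
  have inj: "inj_on p {..<m}" using p(1) by (rule strict_mono_on_imp_inj_on)
  have "monic_lead (\<Prod>a<m. flag_entry p v (a, a) :: 'a mpoly) ?\<mu>"
    using p(2) by (intro monic_lead_prod) (auto simp: flag_entry_def intro!: monic_lead_hsym[unfolded One_nat_def])
  then have "monic_lead (?t id) ?\<mu>" by (simp add: atLeast0LessThan)
  moreover have "neglex_less \<alpha> ?\<mu>" if \<sigma>: "\<sigma> \<in> ?P - {id}" and \<alpha>: "\<alpha> \<in> Poly_Mapping.keys (?t \<sigma>)" for \<sigma> \<alpha>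
  proof -
    let ?f = "\<lambda>a. flag_entry p v (a, \<sigma> a) :: 'a mpoly"
    have k: "\<alpha> \<in> Poly_Mapping.keys (\<Prod>a<m. ?f a)"
      using \<alpha> by (auto simp: in_keys_iff sign_def atLeast0LessThan split: if_splits)
    have nz: "(\<Prod>a<m. ?f a) \<noteq> 0"
    proof
      assume "(\<Prod>a<m. ?f a) = 0"
      with k show False by (simp only: keys_zero empty_iff)
    qed
    \<comment> \<open>A nonzero product has no entry of negative degree, so the subtractions in
      \<open>?w\<close> are exact.\<close>
    have ge: "a \<le> v a + \<sigma> a" if "a < m" for a
    proof (rule ccontr)
      assume "\<not> a \<le> v a + \<sigma> a"
      then have "?f a = 0" by (simp add: flag_entry_def)
      then show False using nz that by (metis finite_lessThan lessThan_iff prod_zero)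
    qed
    let ?w = "\<lambda>a. v a + \<sigma> a - a"
    let ?\<nu> = "\<Sum>a<m. Poly_Mapping.single (p a) (?w a)"
    have "monic_lead (\<Prod>a<m. ?f a) ?\<nu>"
      using p(2) ge by (intro monic_lead_prod) (auto simp: flag_entry_def intro!: monic_lead_hsym[unfolded One_nat_def])
    then have "neglex_le \<alpha> ?\<nu>" using k by (rule monic_lead_keys)
    moreover have "neglex_less ?\<nu> ?\<mu>"
    proof -
      obtain a where a: "a < m" "\<sigma> a < a" "\<And>b. b > a \<Longrightarrow> \<sigma> b = b"
        using permutes_last_moved[of \<sigma> m] \<sigma> by auto
      have "?w a < v a" using a(2) ge[OF a(1)] by simp
      then have "Poly_Mapping.lookup ?\<nu> (p a) < Poly_Mapping.lookup ?\<mu> (p a)"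
        using a(1) by (simp add: lookup_sum_single[OF inj])
      moreover have "Poly_Mapping.lookup ?\<nu> j = Poly_Mapping.lookup ?\<mu> j" if "j > p a" for j
      proof (cases "j \<in> p ` {..<m}")
        case True
        then obtain b where b: "b < m" "j = p b" by auto
        then have "b > a" using that strict_mono_on_leD[OF p(1), of b a] a(1) by (cases "b \<le> a") auto
        then show ?thesis using b a(3) by (simp add: lookup_sum_single[OF inj])
      next
        case False
        then show ?thesis by (simp add: lookup_sum_single[OF inj])
      qed
      ultimately show ?thesis unfolding neglex_less_def by blast
    qed
    ultimately show ?thesis using neglex_less_trans by (auto simp: neglex_le_iff)
  qed
  then have "neglex_less \<alpha> ?\<mu>" if "\<alpha> \<in> Poly_Mapping.keys (\<Sum>\<sigma>\<in>?P - {id}. ?t \<sigma>)" for \<alpha>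
    using keys_sum_subset[of ?t "?P - {id}"] that by blast
  ultimately show ?thesis unfolding eq by (rule monic_lead_add)
qed

section \<open>Demazure operators acting on flags\<close>

lemma swap_idx_image_atLeastAtMost:
  assumes "q \<noteq> i" "1 \<le> i"
  shows "swap_idx i ` {1..q} = {1..q}"
proof -
  have sub: "swap_idx i ` {1..q} \<subseteq> {1..q}" using assms by (auto simp: swap_idx_def)
  have "j \<in> swap_idx i ` {1..q}" if "j \<in> {1..q}" for j
    using that sub by (metis image_eqI subsetD swap_idx_involution)
  with sub show ?thesis by blast
qed

lemma swap_idx_image_own:
  assumes "1 \<le> i"
  shows "swap_idx i ` {1..i} = insert (i + 1) {1..i - 1}"
proof -
  have "{1..i} = insert i {1..i - 1}" using assms by auto
  moreover have "swap_idx i ` {1..i - 1} = (\<lambda>j. j) ` {1..i - 1}"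
    by (rule image_cong) (use assms in \<open>auto simp: swap_idx_def\<close>)
  moreover have "swap_idx i i = i + 1" by (simp add: swap_idx_def)
  ultimately show ?thesis by (simp only: image_insert image_ident)
qed

text \<open>No flag value of the other rows is \<open>i\<close>, so they are symmetric in x_i and
  x_{i+1}. Hence pi_i acts on row \<open>r\<close> alone, where it turns h_d(x_1, ..., x_i) into
  h_d(x_1, ..., x_{i+1}).\<close>

lemma demazure_op_flagged_schur:
  assumes "r < m" "1 \<le> i" "p r = i + 1" "\<And>a. a < m \<Longrightarrow> p a \<noteq> i"
  shows "demazure_op i (flagged_schur m (p(r := i)) v) = (flagged_schur m p v :: ('a::field) mpoly)"
proof (rule demazure_op_eqI)
  let ?f = "flag_entry (p(r := i)) v :: _ \<Rightarrow> 'a mpoly" and ?h = "flag_entry p v :: _ \<Rightarrow> 'a mpoly"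
  let ?g = "\<lambda>ab. swap_poly i (?f ab)"
  have swap: "swap_poly i (flagged_schur m (p(r := i)) v) = det (mat m m ?g)"
    unfolding flagged_schur_def swap_poly.hom_det[symmetric]
    by (rule arg_cong[of _ _ det]) (rule eq_matI, auto)
  have "(var i - var (i + 1)) * det (mat m m ?h) = var i * det (mat m m ?f) - var (i + 1) * det (mat m m ?g)"
  proof (rule det_row_combination[OF assms(1)])
    fix a b assume "a < m" "b < m" "a \<noteq> r"
    then show "?f (a, b) = ?h (a, b) \<and> ?g (a, b) = ?h (a, b)"
      using assms(2,4) swap_idx_image_atLeastAtMost[of "p a" i]
      by (auto simp: flag_entry_def swap_poly_hsym)
  next
    fix b assume "b < m"
    have 1: "{1..i + 1} = insert i (insert (i + 1) {1..i - 1})" and 2: "{1..i} = insert i {1..i - 1}"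
      using assms(2) by auto
    show "(var i - var (i + 1)) * ?h (r, b) = var i * ?f (r, b) - var (i + 1) * ?g (r, b)"
    proof (cases "r \<le> v r + b")
      case True
      have "?f (r, b) = hsym var {1..i} (v r + b - r)" using True by (simp add: flag_entry_def)
      moreover from this have "?g (r, b) = hsym var (insert (i + 1) {1..i - 1}) (v r + b - r)"
        by (simp only: swap_poly_hsym[OF finite_atLeastAtMost] swap_idx_image_own[OF assms(2)])
      moreover have "?h (r, b) = hsym var (insert i (insert (i + 1) {1..i - 1})) (v r + b - r)"
        using True assms(3) 1 by (simp add: flag_entry_def)
      ultimately show ?thesis
        using hsym_difference[of "{1..i - 1}" i "i + 1" "var :: nat \<Rightarrow> 'a mpoly" "v r + b - r"] assms(2)
        unfolding 2 by auto
    qed (simp add: flag_entry_def)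
  qed
  then show "(var i - var (i + 1)) * (flagged_schur m p v :: 'a mpoly) = var i * flagged_schur m (p(r := i)) v
      - var (i + 1) * swap_poly i (flagged_schur m (p(r := i)) v)"
    using swap by (simp only: flagged_schur_def)
qed

text \<open>\<open>p a\<close> is the 1-based position and \<open>v a\<close> the value of the \<open>a\<close>-th nonzero part of \<open>\<gamma>\<close>, counted from 0.\<close>

definition flag_rep :: "nat list \<Rightarrow> nat \<Rightarrow> (nat \<Rightarrow> nat) \<Rightarrow> (nat \<Rightarrow> nat) \<Rightarrow> bool" where
  "flag_rep \<gamma> m p v \<longleftrightarrow>
     (\<forall>a<m. 1 \<le> p a \<and> p a \<le> length \<gamma> \<and> 0 < v a \<and> \<gamma> ! (p a - 1) = v a) \<and>
     (\<forall>j<length \<gamma>. \<gamma> ! j \<noteq> 0 \<longrightarrow> (\<exists>a<m. p a = j + 1)) \<and>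
     (\<forall>a b. a < b \<longrightarrow> b < m \<longrightarrow> p a < p b \<and> v b \<le> v a)"

lemma flag_rep_strict_mono: "flag_rep \<gamma> m p v \<Longrightarrow> strict_mono_on {..<m} p"
  by (simp add: flag_rep_def strict_mono_on_def)

lemma flag_rep_monomial:
  assumes "flag_rep \<gamma> m p v"
  shows "(\<Sum>j<length \<gamma>. Poly_Mapping.single (j + 1) (\<gamma> ! j)) = (\<Sum>a<m. Poly_Mapping.single (p a) (v a))"
proof -
  have inj: "inj_on p {..<m}"
    using flag_rep_strict_mono[OF assms] by (rule strict_mono_on_imp_inj_on)
  have pos: "1 \<le> p a" "p a - 1 < length \<gamma>" "\<gamma> ! (p a - 1) = v a" if "a < m" for a
    using assms that Suc_le_lessD[of "p a - 1" "length \<gamma>"] by (auto simp: flag_rep_def)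
  have inj': "inj_on (\<lambda>a. p a - 1) {..<m}"
  proof (rule inj_onI)
    fix a b assume ab: "a \<in> {..<m}" "b \<in> {..<m}" "p a - 1 = p b - 1"
    then have "p a = p b" using pos(1)[of a] pos(1)[of b] by simp
    then show "a = b" using inj ab by (simp add: inj_on_eq_iff)
  qed
  have "(\<Sum>j<length \<gamma>. Poly_Mapping.single (j + 1) (\<gamma> ! j)) =
     (\<Sum>j\<in>(\<lambda>a. p a - 1) ` {..<m}. Poly_Mapping.single (j + 1) (\<gamma> ! j))"
  proof (rule sum.mono_neutral_right)
    show "\<forall>j\<in>{..<length \<gamma>} - (\<lambda>a. p a - 1) ` {..<m}. Poly_Mapping.single (j + 1) (\<gamma> ! j) = 0"
    proof
      fix j assume j: "j \<in> {..<length \<gamma>} - (\<lambda>a. p a - 1) ` {..<m}"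
      have "\<gamma> ! j = 0"
      proof (rule ccontr)
        assume "\<gamma> ! j \<noteq> 0"
        then obtain a where "a < m" "p a = j + 1" using assms j by (auto simp: flag_rep_def)
        then have "j = p a - 1" "a \<in> {..<m}" by auto
        then show False using j by blast
      qed
      then show "Poly_Mapping.single (j + 1) (\<gamma> ! j) = 0" by simp
    qed
  qed (use pos in auto)
  also have "\<dots> = (\<Sum>a<m. Poly_Mapping.single (p a) (v a))"
    unfolding sum.reindex[OF inj'] using pos by (intro sum.cong) (auto simp: Suc_le_eq)
  finally show ?thesis .
qed

text \<open>Since the nonzero parts never increase, an ascent consists of a zero followed by a
  nonzero part. The swap moves this one part a single place to the left and keeps its index and
  value.\<close>

lemma flag_rep_ascent:
  assumes rep: "flag_rep \<gamma> m p v" and asc: "has_ascent \<gamma> i"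
  obtains r where "r < m" "p r = i + 1" "\<And>a. a < m \<Longrightarrow> p a \<noteq> i"
    "flag_rep (swap_comp i \<gamma>) m (p(r := i)) v"
proof -
  have i: "1 \<le> i" "i < length \<gamma>" "\<gamma> ! (i - 1) < \<gamma> ! i"
    using asc by (auto simp: has_ascent_def)
  have P: "1 \<le> p a" "p a \<le> length \<gamma>" "0 < v a" "\<gamma> ! (p a - 1) = v a" if "a < m" for a
    using rep that by (auto simp: flag_rep_def)
  have O: "\<exists>a<m. p a = j + 1" if "j < length \<gamma>" "\<gamma> ! j \<noteq> 0" for j
    using rep that by (auto simp: flag_rep_def)
  have M: "p a < p b" "v b \<le> v a" if "a < b" "b < m" for a b
    using rep that by (auto simp: flag_rep_def)
  obtain r where r: "r < m" "p r = i + 1" using O[of i] i by auto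
  \<comment> \<open>A nonzero entry at position \<open>i\<close> would be an earlier part than
    \<open>r\<close>, hence at least as large as the next entry.\<close>
  have ne: "p a \<noteq> i" if a: "a < m" for a
  proof
    assume pa: "p a = i"
    have "\<not> r \<le> a" using M(1)[of r a] a r pa by (cases "r = a") auto
    then have "v r \<le> v a" using M(2)[of a r] r by simp
    moreover have "v a = \<gamma> ! (i - 1)" "v r = \<gamma> ! i" using P(4)[of a] P(4)[of r] a r pa by auto
    ultimately show False using i by simp
  qed
  have z: "\<gamma> ! (i - 1) = 0"
  proof (rule ccontr)
    assume "\<gamma> ! (i - 1) \<noteq> 0"
    moreover have "i - 1 < length \<gamma>" using i by simp
    ultimately obtain a where "a < m" "p a = i - 1 + 1" using O[of "i - 1"] by blast
    then show False using ne[of a] i by simp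
  qed
  have len: "length (swap_comp i \<gamma>) = length \<gamma>" by (simp add: swap_comp_def)
  have nth: "swap_comp i \<gamma> ! j = (if j = i then 0 else if j = i - 1 then \<gamma> ! i else \<gamma> ! j)"
    if "j < length \<gamma>" for j
    using that i z by (auto simp: swap_comp_def nth_list_update)
  have pne: "p a \<noteq> i + 1" if "a < m" "a \<noteq> r" for a
    using M(1)[of a r] M(1)[of r a] that r by (cases a r rule: linorder_cases) auto
  have "flag_rep (swap_comp i \<gamma>) m (p(r := i)) v"
    unfolding flag_rep_def len
  proof (intro conjI allI impI)
    fix a assume a: "a < m"
    show "1 \<le> (p(r := i)) a" "(p(r := i)) a \<le> length \<gamma>" "0 < v a"
      using P[OF a] i by auto
    show "swap_comp i \<gamma> ! ((p(r := i)) a - 1) = v a"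
    proof (cases "a = r")
      case True
      then show ?thesis using nth[of "i - 1"] i P(4)[OF r(1)] r(2) by auto
    next
      case False
      then show ?thesis using P[OF a] nth[of "p a - 1"] ne[OF a] pne[OF a False] i by auto
    qed
  next
    fix j assume j: "j < length \<gamma>" "swap_comp i \<gamma> ! j \<noteq> 0"
    show "\<exists>a<m. (p(r := i)) a = j + 1"
    proof (cases "j = i - 1")
      case True
      then show ?thesis using r i by (intro exI[of _ r]) auto
    next
      case False
      then have "j \<noteq> i" "\<gamma> ! j \<noteq> 0" using j nth[OF j(1)] by (auto split: if_splits)
      then obtain a where "a < m" "p a = j + 1" using O j by auto
      then show ?thesis using r \<open>j \<noteq> i\<close> by (intro exI[of _ a]) auto
    qed
  next
    fix a b assume ab: "a < b" "b < m"
    show "v b \<le> v a" using M ab by simp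
    show "(p(r := i)) a < (p(r := i)) b"
      using M(1)[OF ab] M(1)[of a r] r ne[of a] ab by (auto simp: less_Suc_eq)
  qed
  then show ?thesis using that r ne by blast
qed

text \<open>A zero directly before a nonzero part would be an ascent, so the parts fill the first
  positions without gaps.\<close>

lemma flag_rep_no_ascent:
  assumes rep: "flag_rep \<gamma> m p v" and no: "\<nexists>i. has_ascent \<gamma> i" and "a < m"
  shows "p a = Suc a"
  using \<open>a < m\<close>
proof (induction a rule: less_induct)
  case (less a)
  have P: "1 \<le> p a" "p a \<le> length \<gamma>" "0 < v a" "\<gamma> ! (p a - 1) = v a"
    using rep less.prems by (auto simp: flag_rep_def)
  have ge: "Suc a \<le> p a"
  proof (cases a)
    case (Suc b)
    then have "p b < p a" using rep less.prems by (auto simp: flag_rep_def)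
    then show ?thesis using less.IH[of b] less.prems Suc by simp
  qed (use P in simp)
  show ?case
  proof (rule ccontr)
    assume "p a \<noteq> Suc a"
    with ge have gt: "Suc a < p a" by simp
    have "\<gamma> ! (p a - 1 - 1) = 0"
    proof (rule ccontr)
      assume "\<gamma> ! (p a - 1 - 1) \<noteq> 0"
      moreover have "p a - 1 - 1 < length \<gamma>" using P gt by simp
      ultimately obtain b where b: "b < m" "p b = p a - 1 - 1 + 1"
        using rep unfolding flag_rep_def by blast
      have "\<not> a \<le> b"
      proof
        assume "a \<le> b"
        then have "p a \<le> p b" using rep b(1) by (cases "a = b") (auto simp: flag_rep_def intro: less_imp_le)
        with b gt show False by simp
      qed
      then have "p b = Suc b" using less.IH[of b] b by simp
      with b gt \<open>\<not> a \<le> b\<close> show False by simp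
    qed
    then have "has_ascent \<gamma> (p a - 1)" using P gt by (auto simp: has_ascent_def)
    with no show False by blast
  qed
qed

text \<open>Each Demazure step lowers one position by 1, so the sum of the positions bounds the
  recursion depth. When the counter is 0 this sum is 0, and there are no parts at all.\<close>

lemma kappa_aux_eq_flagged_schur:
  assumes "flag_rep \<gamma> m p v" "(\<Sum>a<m. p a) \<le> fuel"
  shows "kappa_aux fuel \<gamma> = (flagged_schur m p v :: ('a::field) mpoly)"
proof -
  have base: "xpow \<gamma> = (flagged_schur m p v :: 'a mpoly)"
    if rep: "flag_rep \<gamma> m p v" and p: "\<And>a. a < m \<Longrightarrow> p a = Suc a" for \<gamma> p
  proof -
    have "xpow \<gamma> = (\<Prod>a<m. var (p a) ^ v a :: 'a mpoly)"
      unfolding xpow_def flag_rep_monomial[OF rep] var_power prod_single ..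
    then show ?thesis using flagged_schur_initial[of m p v, where 'a = 'a] p by simp
  qed
  show ?thesis
    using assms
  proof (induction fuel arbitrary: \<gamma> p)
    case 0
    have "p a = 0" if "a < m" for a using 0 that by simp
    then have "m = 0" using 0(1) by (cases m) (auto simp: flag_rep_def)
    then show ?case using base[OF 0(1)] by simp
  next
    case (Suc fuel)
    show ?case
    proof (cases "\<exists>i. has_ascent \<gamma> i")
      case False
      then show ?thesis using base[OF Suc.prems(1) flag_rep_no_ascent[OF Suc.prems(1)]] by auto
    next
      case True
      define i where "i = (LEAST i. has_ascent \<gamma> i)"
      have i: "has_ascent \<gamma> i" unfolding i_def using True by (metis LeastI)
      obtain r where r: "r < m" "p r = i + 1" "\<And>a. a < m \<Longrightarrow> p a \<noteq> i"
          "flag_rep (swap_comp i \<gamma>) m (p(r := i)) v"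
        using flag_rep_ascent[OF Suc.prems(1) i] by blast
      have "(\<Sum>a<m. p a) = p r + (\<Sum>a\<in>{..<m} - {r}. p a)"
        using r(1) by (intro sum.remove) auto
      moreover have "(\<Sum>a<m. (p(r := i)) a) = i + (\<Sum>a\<in>{..<m} - {r}. (p(r := i)) a)"
        using r(1) by (subst sum.remove[of _ r]) auto
      moreover have "(\<Sum>a\<in>{..<m} - {r}. (p(r := i)) a) = (\<Sum>a\<in>{..<m} - {r}. p a)"
        by (intro sum.cong) auto
      ultimately have "(\<Sum>a<m. (p(r := i)) a) \<le> fuel" using Suc.prems(2) r(2) by linarith
      then have "kappa_aux fuel (swap_comp i \<gamma>) = (flagged_schur m (p(r := i)) v :: 'a mpoly)"
        by (rule Suc.IH[OF r(4)])
      moreover have "kappa_aux (Suc fuel) \<gamma> = (demazure_op i (kappa_aux fuel (swap_comp i \<gamma>)) :: 'a mpoly)"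
        using True by (simp add: i_def Let_def)
      ultimately show ?thesis
        using demazure_op_flagged_schur[of r m i p v, where 'a = 'a] r(1-3) i by (simp add: has_ascent_def)
    qed
  qed
qed

text \<open>There are at most \<open>length \<gamma>\<close> parts, at positions at most
  \<open>length \<gamma>\<close>, so the initial counter suffices.\<close>

lemma kappa_eq_flagged_schur:
  assumes "flag_rep \<gamma> m p v"
  shows "kappa \<gamma> = (flagged_schur m p v :: ('a::field) mpoly)"
proof -
  have "inj_on p {..<m}"
    using flag_rep_strict_mono[OF assms] by (rule strict_mono_on_imp_inj_on)
  moreover have sub: "p ` {..<m} \<subseteq> {1..length \<gamma>}" using assms by (auto simp: flag_rep_def)
  ultimately have "m \<le> length \<gamma>" using card_mono[OF _ sub] by (simp add: card_image)
  have "(\<Sum>a<m. p a) \<le> (\<Sum>a<m. length \<gamma>)"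
    using assms by (intro sum_mono) (auto simp: flag_rep_def)
  also have "\<dots> \<le> length \<gamma> * length \<gamma>" using \<open>m \<le> length \<gamma>\<close> by simp
  finally show ?thesis unfolding kappa_def by (rule kappa_aux_eq_flagged_schur[OF assms])
qed

section \<open>Membership in the ideal\<close>

lemma poly_ring_0 [simp]: "0 \<in> poly_ring n" and poly_ring_1 [simp]: "1 \<in> poly_ring n"
  by (auto simp: poly_ring_def)

lemma poly_ring_add: "f \<in> poly_ring n \<Longrightarrow> g \<in> poly_ring n \<Longrightarrow> f + g \<in> poly_ring n"
  unfolding poly_ring_def using keys_add[of f g] by auto

lemma poly_ring_uminus: "f \<in> poly_ring n \<Longrightarrow> - f \<in> poly_ring n"
  by (simp add: poly_ring_def in_keys_iff)

lemma poly_ring_mult: "f \<in> poly_ring n \<Longrightarrow> g \<in> poly_ring n \<Longrightarrow> f * g \<in> poly_ring n"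
  unfolding poly_ring_def using keys_mult[of f g] by (auto dest!: subsetD)

lemma poly_ring_sum: "(\<And>i. i \<in> A \<Longrightarrow> f i \<in> poly_ring n) \<Longrightarrow> sum f A \<in> poly_ring n"
  by (induction A rule: infinite_finite_induct) (auto intro: poly_ring_add)

lemma poly_ring_prod: "(\<And>i. i \<in> A \<Longrightarrow> f i \<in> poly_ring n) \<Longrightarrow> prod f A \<in> poly_ring n"
  by (induction A rule: infinite_finite_induct) (auto intro: poly_ring_mult)

lemma poly_ring_minus_one_power: "(-1) ^ d \<in> poly_ring n"
  by (induction d) (simp_all add: poly_ring_uminus)

lemma poly_ring_single: "in_vars n \<alpha> \<Longrightarrow> Poly_Mapping.single \<alpha> c \<in> poly_ring n"
  by (auto simp: poly_ring_def split: if_splits)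

lemma poly_ring_hsym: "p \<le> n \<Longrightarrow> hsym var {1..p} d \<in> poly_ring n"
  unfolding h_poly_eq_hsym[symmetric] h_poly_def
  by (intro poly_ring_sum poly_ring_single) (auto elim: in_vars_mono)

lemma poly_ring_esym: "esym var {1..n} d \<in> poly_ring n"
proof -
  have "e_poly d n \<in> poly_ring n"
    unfolding e_poly_def by (intro poly_ring_sum poly_ring_single) auto
  then have "(-1) ^ d * e_poly d n \<in> poly_ring n"
    by (intro poly_ring_mult poly_ring_minus_one_power)
  then show ?thesis by (simp add: e_poly_eq_esym)
qed

lemma ideal_gen_sum: "(\<And>i. i \<in> A \<Longrightarrow> f i \<in> ideal_gen n G) \<Longrightarrow> sum f A \<in> ideal_gen n G"
  by (induction A rule: infinite_finite_induct) (auto intro: ideal_gen.zero ideal_gen.add)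

lemma ideal_gen_uminus: "f \<in> ideal_gen n G \<Longrightarrow> - f \<in> ideal_gen n G"
  using ideal_gen.mult[OF poly_ring_uminus[OF poly_ring_1], of f n G] by simp

text \<open>Every Leibniz term contains exactly one factor from column \<open>l\<close>.\<close>

lemma det_in_ideal:
  assumes "l < m" "\<And>a b. a < m \<Longrightarrow> b < m \<Longrightarrow> f (a, b) \<in> poly_ring n"
    and "\<And>a. a < m \<Longrightarrow> f (a, l) \<in> ideal_gen n G"
  shows "det (mat m m f) \<in> ideal_gen n G"
proof -
  have "signof \<sigma> * (\<Prod>a = 0..<m. mat m m f $$ (a, \<sigma> a)) \<in> ideal_gen n G"
    if \<sigma>: "\<sigma> permutes {0..<m}" for \<sigma>
  proof -
    have \<sigma>m: "\<sigma> a < m" if "a < m" for a using permutes_in_image[OF \<sigma>, of a] that by simp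
    obtain r where r: "r < m" "\<sigma> r = l"
      using permutes_image[OF \<sigma>] assms(1) by (metis atLeastLessThan_iff imageE le0)
    have "(\<Prod>a = 0..<m. mat m m f $$ (a, \<sigma> a)) = (\<Prod>a\<in>{0..<m}. f (a, \<sigma> a))"
      using \<sigma>m by (intro prod.cong) auto
    also have "\<dots> = (\<Prod>a\<in>{0..<m} - {r}. f (a, \<sigma> a)) * f (r, \<sigma> r)"
      using r by (subst prod.remove[of _ r]) (auto simp: mult.commute)
    finally have eq: "(\<Prod>a = 0..<m. mat m m f $$ (a, \<sigma> a)) =
      (\<Prod>a\<in>{0..<m} - {r}. f (a, \<sigma> a)) * f (r, \<sigma> r)" .
    have "signof \<sigma> \<in> poly_ring n" by (simp add: sign_def poly_ring_uminus)
    moreover have "(\<Prod>a\<in>{0..<m} - {r}. f (a, \<sigma> a)) \<in> poly_ring n"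
      using \<sigma>m assms(2) by (intro poly_ring_prod) simp
    moreover have "f (r, \<sigma> r) \<in> ideal_gen n G" using r assms(3) by simp
    ultimately show ?thesis unfolding eq by (intro ideal_gen.mult)
  qed
  then show ?thesis by (subst det_def'[of _ m]) (auto intro: ideal_gen_sum)
qed

text \<open>With $d = n + 1 - p$, the coefficient of $t^d$ in
  $\prod_{i \le n} (1 - x_i t) / \prod_{i \le p} (1 - x_i t)$ vanishes. Modulo the generators $e_j$ this is
  a linear relation between the columns of the flagged matrix that does not depend on the row.\<close>

lemma flagged_schur_in_J_ideal:
  assumes k: "1 \<le> k" "k \<le> n" and m: "m = n - k + 1"
    and p: "\<And>a. a < m \<Longrightarrow> 1 \<le> p a \<and> p a \<le> n \<and> p a \<le> k + a"
    and v: "\<And>a. a < m \<Longrightarrow> v a = k + 1 + a - p a"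
  shows "(flagged_schur m p v :: ('a::field) mpoly) \<in> J_ideal n k"
proof -
  define l where "l = n - k"
  have l: "l < m" "m = Suc l" using m by (auto simp: l_def)
  \<comment> \<open>The identity matrix with its last column replaced. It stays unitriangular,
    because the corner entry is \<open>esym\<close> of degree 0.\<close>
  define g :: "nat \<times> nat \<Rightarrow> 'a mpoly" where
    "g = (\<lambda>(c, b). if b = l then esym var {1..n} (l - c) else if c = b then 1 else 0)"
  define T :: "nat \<times> nat \<Rightarrow> 'a mpoly" where
    "T = (\<lambda>(a, b). \<Sum>c\<le>b. flag_entry p v (a, c) * g (c, b))"
  have entry: "flag_entry p v (a, b) \<in> (poly_ring n :: 'a mpoly set)" if "a < m" for a b
    unfolding flag_entry_def
    by (simp, rule impI, rule poly_ring_hsym[unfolded One_nat_def]) (use p[OF that] in simp)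
  have e: "esym var {1..n} j \<in> (J_ideal n k :: 'a mpoly set)" if "j \<in> {m..n}" for j
  proof -
    have "e_poly j n \<in> (J_ideal n k :: 'a mpoly set)"
      unfolding J_ideal_def using that m by (intro ideal_gen.gen UnI2 CollectI exI[of _ j]) simp
    then have "(-1) ^ j * e_poly j n \<in> (J_ideal n k :: 'a mpoly set)"
      unfolding J_ideal_def by (intro ideal_gen.mult poly_ring_minus_one_power)
    then show ?thesis by (simp add: e_poly_eq_esym)
  qed
  have det: "flagged_schur m p v = det (mat m m T)"
    unfolding flagged_schur_def T_def by (rule det_mat_mult_unitriangular) (use l in \<open>auto simp: g_def\<close>)
  obtain G where G: "J_ideal n k = ideal_gen n (G :: 'a mpoly set)"
    unfolding J_ideal_def by blast
  have "det (mat m m T) \<in> J_ideal n k"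
    unfolding G
  proof (rule det_in_ideal[OF l(1)])
    fix a b assume a: "a < m"
    have "g (c, b) \<in> poly_ring n" for c
      by (simp add: g_def poly_ring_esym[unfolded One_nat_def])
    then show "T (a, b) \<in> poly_ring n"
      unfolding T_def prod.case by (intro poly_ring_sum poly_ring_mult entry a)
  next
    fix a assume a: "a < m"
    \<comment> \<open>By the choice of v_a, the entry of row \<open>a\<close> in the last column has
      degree n + 1 - p_a, one more than the number of variables left after cancellation.\<close>
    define d where "d = n + 1 - p a"
    have d: "a \<le> v a + l" "v a + l - a = d" "d \<le> n"
      using p[OF a] v[OF a] k a m by (auto simp: l_def d_def)
    let ?t = "\<lambda>j. esym var {1..n} j * hsym var {1..p a} (d - j) :: 'a mpoly"
    have "T (a, l) = (\<Sum>c\<le>l. (if a \<le> v a + c then hsym var {1..p a} (v a + c - a) else 0)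
        * esym var {1..n} (l - c))"
      by (simp add: T_def g_def flag_entry_def)
    also have "\<dots> = (\<Sum>j\<in>{..d} \<inter> {..l}. ?t j)"
      unfolding flag_row_convolution using d by simp
    finally have T: "T (a, l) = (\<Sum>j\<in>{..d} \<inter> {..l}. ?t j)" .
    have "(\<Sum>j\<le>d. ?t j) = fps_nth (egen var ({1..n} - {1..p a})) d"
      unfolding esym_hsym_convolution using p[OF a] by (subst egen_mult_hgen_subset) auto
    also have "\<dots> = esym var ({1..n} - {1..p a}) d" by (simp add: esym_def)
    also have "\<dots> = 0"
      using p[OF a] by (intro esym_eq_0) (auto simp: card_Diff_subset d_def)
    finally have "(\<Sum>j\<le>d. ?t j) = 0" .
    moreover have "(\<Sum>j\<le>d. ?t j) = (\<Sum>j\<in>{..d} \<inter> {..l}. ?t j) + (\<Sum>j\<in>{..d} - {..l}. ?t j)"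
      by (rule sum.Int_Diff) simp
    ultimately have "T (a, l) = - (\<Sum>j\<in>{..d} - {..l}. ?t j)"
      unfolding T by (simp add: eq_neg_iff_add_eq_0)
    moreover have "(\<Sum>j\<in>{..d} - {..l}. ?t j) \<in> J_ideal n k"
    proof -
      have "hsym var {1..p a} (d - j) * esym var {1..n} j \<in> (J_ideal n k :: 'a mpoly set)"
        if "j \<in> {..d} - {..l}" for j
      proof -
        have "esym var {1..n} j \<in> (J_ideal n k :: 'a mpoly set)" using that d l by (intro e) auto
        then show ?thesis using poly_ring_hsym[of "p a" n "d - j"] p[OF a]
          unfolding G by (intro ideal_gen.mult) auto
      qed
      then show ?thesis unfolding G by (intro ideal_gen_sum) (simp add: mult.commute)
    qed
    ultimately show "T (a, l) \<in> ideal_gen n G" unfolding G by (simp add: ideal_gen_uminus)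
  qed
  with det show ?thesis by simp
qed

section \<open>Counting standard monomials and points\<close>

text \<open>Gaussian elimination carried out without division, since the coefficients lie only in an
  integral domain.\<close>

lemma homogeneous_system_nontrivial:
  fixes A :: "'e \<Rightarrow> 'y \<Rightarrow> 'b::idom"
  assumes "finite E" "finite Y" "card E < card Y"
  shows "\<exists>c. (\<exists>y\<in>Y. c y \<noteq> 0) \<and> (\<forall>e\<in>E. (\<Sum>y\<in>Y. c y * A e y) = 0)"
  using assms
proof (induction E arbitrary: Y A rule: finite_induct)
  case empty
  then have "Y \<noteq> {}" by auto
  then show ?case by (intro exI[of _ "\<lambda>_. 1"]) auto
next
  case (insert e E)
  show ?case
  proof (cases "\<exists>y\<in>Y. A e y \<noteq> 0")
    case False
    obtain c where "\<exists>y\<in>Y. c y \<noteq> 0" "\<forall>e\<in>E. (\<Sum>y\<in>Y. c y * A e y) = 0"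
      using insert.IH[of Y A] insert.prems insert.hyps by auto
    with False show ?thesis by (intro exI[of _ c]) auto
  next
    case True
    then obtain z where z: "z \<in> Y" "A e z \<noteq> 0" by auto
    let ?Y = "Y - {z}"
    \<comment> \<open>Equation \<open>e'\<close> after the unknown \<open>z\<close> is eliminated by
      cross-multiplication with the pivot \<open>A e z\<close>.\<close>
    define B where "B e' y = A e z * A e' y - A e' z * A e y" for e' y
    have "card E < card ?Y" using insert.prems insert.hyps z by simp
    then obtain c where c: "\<exists>y\<in>?Y. c y \<noteq> 0" "\<forall>e'\<in>E. (\<Sum>y\<in>?Y. c y * B e' y) = 0"
      using insert.IH[of ?Y B] insert.prems by auto
    \<comment> \<open>Scaling the other unknowns by the pivot allows equation \<open>e\<close> to be
      solved for \<open>z\<close> without dividing.\<close>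
    define c' where "c' y = (if y = z then - (\<Sum>y\<in>?Y. A e y * c y) else A e z * c y)" for y
    have sum: "(\<Sum>y\<in>Y. c' y * A e' y) = (\<Sum>y\<in>?Y. c y * B e' y)" for e'
    proof -
      have "(\<Sum>y\<in>Y. c' y * A e' y) = c' z * A e' z + (\<Sum>y\<in>?Y. c' y * A e' y)"
        using z insert.prems by (intro sum.remove) auto
      also have "(\<Sum>y\<in>?Y. c' y * A e' y) = (\<Sum>y\<in>?Y. A e z * c y * A e' y)"
        by (intro sum.cong) (auto simp: c'_def)
      also have "c' z * A e' z = - (\<Sum>y\<in>?Y. A e y * c y * A e' z)"
        by (simp add: c'_def sum_distrib_right)
      also have "- (\<Sum>y\<in>?Y. A e y * c y * A e' z) + (\<Sum>y\<in>?Y. A e z * c y * A e' y) = (\<Sum>y\<in>?Y. c y * B e' y)"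
        unfolding sum_negf[symmetric] sum.distrib[symmetric]
        by (intro sum.cong) (auto simp: B_def algebra_simps)
      finally show ?thesis .
    qed
    have "B e y = 0" for y by (simp add: B_def)
    then have "(\<Sum>y\<in>Y. c' y * A e' y) = 0" if "e' \<in> insert e E" for e'
      unfolding sum using that c(2) by auto
    moreover have "\<exists>y\<in>Y. c' y \<noteq> 0" using c(1) z(2) by (auto simp: c'_def)
    ultimately show ?thesis by blast
  qed
qed

text \<open>The counter records entries that do not exceed it. Starting from 0, an entry exceeding
  the counter is large enough to dominate the next part of some \<gamma>(S), so the counter is the
  number of indices left out of S.\<close>

fun greedy :: "nat \<Rightarrow> nat list \<Rightarrow> nat" where
  "greedy d [] = d"
| "greedy d (b # bs) = greedy (if b \<le> d then Suc d else d) bs"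

definition greedy_lists :: "nat \<Rightarrow> nat \<Rightarrow> nat \<Rightarrow> nat list set" where
  "greedy_lists k n d = {bs. length bs = n \<and> set bs \<subseteq> {..<k} \<and> k \<le> greedy d bs}"

lemma greedy_ge: "d \<le> greedy d bs"
  by (induction bs arbitrary: d) (auto intro: le_trans[OF le_SucI] Suc_leD)

lemma card_Cons_Sigma:
  assumes "finite C" "\<And>y. y \<in> C \<Longrightarrow> finite (S y)"
  shows "card {y # ys | y ys. y \<in> C \<and> ys \<in> S y} = (\<Sum>y\<in>C. card (S y))"
proof -
  have "{y # ys | y ys. y \<in> C \<and> ys \<in> S y} = (\<lambda>(y, ys). y # ys) ` (SIGMA y:C. S y)" by auto
  moreover have "inj_on (\<lambda>(y, ys). y # ys) (SIGMA y:C. S y)" by (auto simp: inj_on_def)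
  ultimately show ?thesis using assms by (simp add: card_image)
qed

lemma finite_greedy_lists: "finite (greedy_lists k n d)"
  by (rule finite_subset[OF _ finite_lists_length_eq[of "{..<k}" n]]) (auto simp: greedy_lists_def)

text \<open>Of the k possible first entries, d + 1 raise the counter and k - 1 - d leave it
  unchanged.\<close>

lemma card_greedy_lists_Suc:
  assumes "d < k"
  shows "card (greedy_lists k (Suc n) d) =
    Suc d * card (greedy_lists k n (Suc d)) + (k - 1 - d) * card (greedy_lists k n d)"
proof -
  let ?S = "\<lambda>b. greedy_lists k n (if b \<le> d then Suc d else d)"
  have "greedy_lists k (Suc n) d = {b # bs | b bs. b \<in> {..<k} \<and> bs \<in> ?S b}"
    by (auto simp: greedy_lists_def length_Suc_conv simp del: if_split split del: if_split)
  then have "card (greedy_lists k (Suc n) d) = (\<Sum>b<k. card (?S b))"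
    by (simp only: card_Cons_Sigma finite_lessThan finite_greedy_lists)
  also have "{..<k} = {..d} \<union> {Suc d..<k}" using assms by auto
  also have "(\<Sum>b\<in>{..d} \<union> {Suc d..<k}. card (?S b)) =
      (\<Sum>b\<in>{..d}. card (?S b)) + (\<Sum>b\<in>{Suc d..<k}. card (?S b))"
    by (intro sum.union_disjoint) auto
  finally show ?thesis by simp
qed

lemma card_greedy_lists_full: "card (greedy_lists k n k) = k ^ n"
proof -
  have "greedy_lists k n k = {bs. set bs \<subseteq> {..<k} \<and> length bs = n}"
    using greedy_ge by (auto simp: greedy_lists_def)
  then show ?thesis using card_lists_length_eq[of "{..<k}" n] by simp
qed

text \<open>\<open>e\<close> is the number of increments still missing. The factor
  \<open>fact (k - e)\<close> absorbs the weight d + 1 of an increment, which leaves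
  \<open>hsym_insert\<close> with the new letter e - 1.\<close>

lemma card_greedy_lists:
  assumes "e \<le> k"
  shows "fact (k - e) * int (card (greedy_lists k n (k - e))) =
    fact k * (if e \<le> n then hsym int (insert k {0..<e}) (n - e) else 0)"
  using assms
proof (induction n arbitrary: e)
  case 0
  show ?case
  proof (cases e)
    case 0
    then show ?thesis by (simp add: card_greedy_lists_full)
  next
    case (Suc e')
    then have "greedy_lists k 0 (k - e) = {}" using 0 by (auto simp: greedy_lists_def)
    then show ?thesis using Suc by simp
  qed
next
  case (Suc n)
  show ?case
  proof (cases e)
    case 0
    then show ?thesis by (simp add: card_greedy_lists_full)
  next
    case (Suc e')
    define d where "d = k - e"
    have d: "d < k" "k - 1 - d = e'" "Suc d = k - e'" "d = k - e"
      using Suc \<open>e \<le> k\<close> by (auto simp: d_def)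
    have IH1: "fact (k - e') * int (card (greedy_lists k n (k - e'))) =
        fact k * (if e' \<le> n then hsym int (insert k {0..<e'}) (n - e') else 0)"
      using Suc \<open>e \<le> k\<close> by (intro Suc.IH) simp
    have IH2: "fact (k - e) * int (card (greedy_lists k n (k - e))) =
        fact k * (if e \<le> n then hsym int (insert k {0..<e}) (n - e) else 0)"
      using \<open>e \<le> k\<close> by (intro Suc.IH) simp
    have fct: "fact (k - e') = int (Suc d) * fact d" using d(3)[symmetric] by simp
    have "fact (k - e) * int (card (greedy_lists k (Suc n) (k - e))) =
        fact (k - e') * int (card (greedy_lists k n (k - e'))) +
        int e' * (fact (k - e) * int (card (greedy_lists k n (k - e))))"
      unfolding d(4)[symmetric] card_greedy_lists_Suc[OF d(1)] d(2) fct d(3)[symmetric]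
      by (simp add: algebra_simps)
    also have "\<dots> = fact k * (if e \<le> Suc n then hsym int (insert k {0..<e}) (Suc n - e) else 0)"
    proof -
      have ins: "insert k {0..<e} = insert e' (insert k {0..<e'})"
        unfolding Suc by (auto simp: atLeastLessThanSuc)
      have "e' \<notin> insert k {0..<e'}" using Suc \<open>e \<le> k\<close> by auto
      then have "hsym int (insert k {0..<e}) (Suc r) =
          hsym int (insert k {0..<e'}) (Suc r) + int e' * hsym int (insert k {0..<e}) r" for r
        unfolding ins by (intro hsym_insert) auto
      moreover have "n - e' = Suc (n - e)" if "e \<le> n" using that Suc by simp
      ultimately show ?thesis unfolding IH1 IH2 using Suc
        by (cases "e \<le> n"; cases "e = Suc n") (auto simp: algebra_simps)
    qed
    finally show ?thesis .
  qed
qed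

text \<open>\<open>U\<close> is the set of labels already placed.\<close>

fun valid_labels :: "nat \<Rightarrow> nat set \<Rightarrow> nat list \<Rightarrow> bool" where
  "valid_labels k U [] \<longleftrightarrow> {..<k} \<subseteq> U"
| "valid_labels k U (y # ys) \<longleftrightarrow> y \<notin> U \<and> y < k + card U \<and> valid_labels k (insert y U) ys"

lemma valid_labels_props:
  assumes "finite U" "valid_labels k U ys"
  shows "distinct ys" "set ys \<inter> U = {}" "{..<k} \<subseteq> U \<union> set ys"
    "i < length ys \<Longrightarrow> ys ! i < k + card U + i"
  using assms
proof (induction ys arbitrary: U i)
  case (Cons y ys)
  {
    case 1
    then show ?case using Cons.IH(1,2)[of "insert y U"] by auto
  next
    case 2
    then show ?case using Cons.IH(2)[of "insert y U"] by auto
  next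
    case 3
    then show ?case using Cons.IH(3)[of "insert y U"] by auto
  next
    case 4
    then show ?case using Cons.IH(4)[of "i - 1" "insert y U"] by (cases i) auto
  }
qed auto

definition label_lists :: "nat \<Rightarrow> nat \<Rightarrow> nat set \<Rightarrow> nat list set" where
  "label_lists k n U = {ys. length ys = n \<and> valid_labels k U ys}"

lemma label_lists_Suc:
  "label_lists k (Suc n) U = {y # ys | y ys. y \<in> {..<k + card U} - U \<and> ys \<in> label_lists k n (insert y U)}"
  by (auto simp: label_lists_def length_Suc_conv)

lemma finite_label_lists: "finite (label_lists k n U)"
proof (induction n arbitrary: U)
  case 0
  have "label_lists k 0 U \<subseteq> {[]}" by (auto simp: label_lists_def)
  then show ?case by (rule finite_subset) simp
next
  case (Suc n)
  have "label_lists k (Suc n) U = (\<Union>y\<in>{..<k + card U} - U. (#) y ` label_lists k n (insert y U))"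
    unfolding label_lists_Suc by auto
  then show ?case using Suc by simp
qed

text \<open>\<open>e\<close> is the number of required labels still missing. Exactly k labels are
  available at each step, e of them required and k - e not; after division by \<open>fact e\<close>
  this is \<open>hsym_insert\<close> with the new letter k - e.\<close>

lemma card_label_lists:
  assumes "finite U" "U \<subseteq> {..<k + card U}" "card ({..<k} - U) = e"
  shows "int (card (label_lists k n U)) =
    fact e * (if e \<le> n then hsym int {k - e..k} (n - e) else 0)"
  using assms
proof (induction n arbitrary: U e)
  case 0
  have "label_lists k 0 U = (if {..<k} \<subseteq> U then {[]} else {})"
    by (auto simp: label_lists_def)
  moreover have "{..<k} \<subseteq> U \<longleftrightarrow> e = 0" using 0(3) by auto
  ultimately show ?case by simp
next
  case (Suc n)
  let ?C = "{..<k + card U} - U"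
  let ?N = "{..<k} - U"
  let ?H = "\<lambda>n e. if e \<le> n then hsym int {k - e..k} (n - e) else 0"
  have ek: "e \<le> k" using Suc.prems(3) card_mono[of "{..<k}" ?N] by auto
  have sub: "insert y U \<subseteq> {..<k + card (insert y U)}" if "y \<in> ?C" for y
    using that Suc.prems by auto
  have new: "int (card (label_lists k n (insert y U))) = fact (e - 1) * ?H n (e - 1)" if "y \<in> ?N" for y
  proof (rule Suc.IH)
    have "{..<k} - insert y U = ?N - {y}" by auto
    then show "card ({..<k} - insert y U) = e - 1" using that Suc.prems by simp
  qed (use that Suc.prems sub in auto)
  have old: "int (card (label_lists k n (insert y U))) = fact e * ?H n e" if "y \<in> ?C - ?N" for y
  proof (rule Suc.IH)
    have "{..<k} - insert y U = ?N" using that by auto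
    then show "card ({..<k} - insert y U) = e" using Suc.prems by simp
  qed (use that Suc.prems sub in auto)
  have NC: "?N \<subseteq> ?C" by auto
  have "card ?C = k" using Suc.prems by (subst card_Diff_subset) auto
  then have cold: "card (?C - ?N) = k - e"
    using Suc.prems by (subst card_Diff_subset[OF _ NC]) auto
  have "int (card (label_lists k (Suc n) U)) = (\<Sum>y\<in>?C. int (card (label_lists k n (insert y U))))"
    unfolding label_lists_Suc by (subst card_Cons_Sigma) (auto simp: finite_label_lists)
  also have "\<dots> = (\<Sum>y\<in>?C - ?N. int (card (label_lists k n (insert y U)))) +
      (\<Sum>y\<in>?N. int (card (label_lists k n (insert y U))))"
    using NC by (intro sum.subset_diff) auto
  also have "(\<Sum>y\<in>?C - ?N. int (card (label_lists k n (insert y U)))) = int (k - e) * (fact e * ?H n e)"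
  proof -
    have "(\<Sum>y\<in>?C - ?N. int (card (label_lists k n (insert y U)))) = (\<Sum>y\<in>?C - ?N. fact e * ?H n e)"
      by (intro sum.cong refl old)
    then show ?thesis by (simp only: sum_constant cold)
  qed
  also have "(\<Sum>y\<in>?N. int (card (label_lists k n (insert y U)))) = int e * (fact (e - 1) * ?H n (e - 1))"
  proof -
    have "(\<Sum>y\<in>?N. int (card (label_lists k n (insert y U)))) = (\<Sum>y\<in>?N. fact (e - 1) * ?H n (e - 1))"
      by (intro sum.cong refl new)
    then show ?thesis by (simp only: sum_constant Suc.prems(3))
  qed
  also have "int (k - e) * (fact e * ?H n e) + int e * (fact (e - 1) * ?H n (e - 1)) = fact e * ?H (Suc n) e"
  proof (cases e)
    case 0
    then show ?thesis by simp
  next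
    case (Suc e')
    have f: "fact e = int e * fact e'" using Suc by simp
    have ins: "{k - e..k} = insert (k - e) {k - e'..k}" using Suc ek by auto
    have "k - e \<notin> {k - e'..k}" using Suc ek by auto
    then have "hsym int {k - e..k} (Suc r) =
          hsym int {k - e'..k} (Suc r) + int (k - e) * hsym int {k - e..k} r" for r
      unfolding ins by (intro hsym_insert) auto
    moreover have "n - e' = Suc (n - e)" if "e \<le> n" using that Suc by simp
    ultimately have "?H (Suc n) e = ?H n e' + int (k - e) * ?H n e"
      using Suc by (cases "e \<le> n"; cases "e = Suc n") auto
    moreover have "e - 1 = e'" using Suc by simp
    ultimately show ?thesis unfolding f by (simp add: algebra_simps)
  qed
  finally show ?case .
qed

lemma card_greedy_eq_card_label:
  assumes "k \<le> n"
  shows "card (greedy_lists k n 0) = card (label_lists k n {})"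
proof -
  have "insert k {0..<k} = {0..k}" by auto
  then have "int (card (greedy_lists k n 0)) = fact k * hsym int {0..k} (n - k)"
    using card_greedy_lists[of k k n] assms by simp
  also have "\<dots> = int (card (label_lists k n {}))"
    using card_label_lists[of "{}" k k n] assms by simp
  finally show ?thesis by simp
qed

section \<open>Moments of weighted point sets\<close>

text \<open>The points live over \<open>'a poly\<close> because the field itself may be finite.\<close>

definition node :: "nat \<Rightarrow> ('a::field) poly" where
  "node j = monom 1 j"

lemma inj_node: "inj node"
  by (auto simp: node_def inj_def dest: arg_cong[of _ _ degree] simp: degree_monom_eq)

definition point :: "nat list \<Rightarrow> nat \<Rightarrow> ('a::field) poly" where
  "point ys i = node (ys ! (i - 1))"

definition moment :: "nat \<Rightarrow> nat \<Rightarrow> (nat list \<Rightarrow> ('a::field) poly) \<Rightarrow> mon \<Rightarrow> 'a poly" where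
  "moment n k c \<alpha> = (\<Sum>ys\<in>label_lists k n {}. c ys * meval n (point ys) \<alpha>)"

text \<open>The functional that maps f to the weighted sum of its values at the points, applied only
  to the component of f of degree \<open>d\<close>.\<close>

definition graded_moment :: "nat \<Rightarrow> nat \<Rightarrow> (nat list \<Rightarrow> ('a::field) poly) \<Rightarrow> nat \<Rightarrow> 'a mpoly \<Rightarrow> 'a poly" where
  "graded_moment n k c d f =
     (\<Sum>\<alpha> | in_vars n \<alpha> \<and> mdeg \<alpha> = d. [:Poly_Mapping.lookup f \<alpha>:] * moment n k c \<alpha>)"

lemma point_reindex:
  assumes "ys \<in> label_lists k n {}" "i \<le> n"
  shows "inj_on (\<lambda>j. ys ! (j - 1)) {1..i}" "(\<lambda>j. ys ! (j - 1)) ` {1..i} = (!) ys ` {..<i}"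
proof -
  have ys: "length ys = n" "distinct ys"
    using assms(1) valid_labels_props(1)[of "{}"] by (auto simp: label_lists_def)
  show "inj_on (\<lambda>j. ys ! (j - 1)) {1..i}"
    using ys assms(2) by (auto simp: inj_on_def nth_eq_iff_index_eq)
  have "(\<lambda>j. j - 1) ` {1..i} = {..<i}"
    by (auto simp: image_iff intro!: bexI[of _ "Suc _"])
  then show "(\<lambda>j. ys ! (j - 1)) ` {1..i} = (!) ys ` {..<i}"
    by (metis (no_types, lifting) image_cong image_image)
qed

lemma hgen_point:
  assumes "ys \<in> label_lists k n {}" "i \<le> n"
  shows "hgen (point ys :: nat \<Rightarrow> ('a::field) poly) {1..i} = hgen node ((!) ys ` {..<i})"
  unfolding point_def[abs_def] hgen_reindex[OF point_reindex(1)[OF assms]] point_reindex(2)[OF assms] ..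

lemma egen_point:
  assumes "ys \<in> label_lists k n {}"
  shows "egen (point ys :: nat \<Rightarrow> ('a::field) poly) {1..n} = egen node (set ys)"
proof -
  have "set ys = (!) ys ` {..<n}"
    using assms by (auto simp: label_lists_def set_conv_nth)
  then show ?thesis
    unfolding point_def[abs_def] egen_reindex[OF point_reindex(1)[OF assms order_refl]]
      point_reindex(2)[OF assms order_refl] by simp
qed

text \<open>The term j = 0 is the value of h_k(x_1, ..., x_i) at the point, and all others have
  lower degree in the coordinates. This is the polynomial vanishing on the points with top component
  h_k.\<close>

lemma hsym_point_relation:
  assumes ys: "ys \<in> label_lists k n {}" and i: "1 \<le> i" "i \<le> n" and "1 \<le> k"
  shows "(\<Sum>j\<le>k. esym node {..<k + i - 1} j * hsym (point ys) {1..i} (k - j)) = (0 :: ('a::field) poly)"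
proof -
  let ?A = "(!) ys ` {..<i}"
  have v: "length ys = n" "valid_labels k {} ys" using ys by (auto simp: label_lists_def)
  have "ys ! j < k + i - 1" if "j < i" for j
    using valid_labels_props(4)[OF _ v(2), of j] that v i by simp
  then have sub: "?A \<subseteq> {..<k + i - 1}" by blast
  have "inj_on ((!) ys) {..<i}"
    using valid_labels_props(1)[OF _ v(2)] v i by (auto simp: inj_on_def nth_eq_iff_index_eq)
  then have card: "card ?A = i" by (simp add: card_image)
  have "(\<Sum>j\<le>k. esym node {..<k + i - 1} j * hsym (point ys) {1..i} (k - j)) =
      fps_nth (egen node {..<k + i - 1} * hgen (node :: nat \<Rightarrow> 'a poly) ?A) k"
    unfolding esym_hsym_convolution hgen_point[OF ys i(2)] ..
  also have "\<dots> = esym (node :: nat \<Rightarrow> 'a poly) ({..<k + i - 1} - ?A) k"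
    using egen_mult_hgen_subset[OF _ sub, where x = "node :: nat \<Rightarrow> 'a poly"] by (simp add: esym_def)
  also have "\<dots> = 0"
    using sub card assms by (intro esym_eq_0) (auto simp: card_Diff_subset)
  finally show ?thesis .
qed

text \<open>Here the top component is the term j = d; the factors in the nodes are
  constants.\<close>

lemma esym_point_relation:
  assumes ys: "ys \<in> label_lists k n {}" and d: "n - k < d"
  shows "(\<Sum>j\<le>d. esym (point ys) {1..n} j * hsym node {..<k} (d - j)) = (0 :: ('a::field) poly)"
proof -
  have v: "length ys = n" "valid_labels k {} ys" using ys by (auto simp: label_lists_def)
  have sub: "{..<k} \<subseteq> set ys" using valid_labels_props(3)[OF _ v(2)] by simp
  have card: "card (set ys) = n" using valid_labels_props(1)[OF _ v(2)] v by (simp add: distinct_card)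
  have "(\<Sum>j\<le>d. esym (point ys) {1..n} j * hsym node {..<k} (d - j)) =
      fps_nth (egen node (set ys) * hgen (node :: nat \<Rightarrow> 'a poly) {..<k}) d"
    unfolding esym_hsym_convolution egen_point[OF ys] ..
  also have "\<dots> = esym (node :: nat \<Rightarrow> 'a poly) (set ys - {..<k}) d"
    using egen_mult_hgen_subset[OF _ sub, where x = "node :: nat \<Rightarrow> 'a poly"] by (simp add: esym_def)
  also have "\<dots> = 0"
    using sub card d by (intro esym_eq_0) (auto simp: card_Diff_subset)
  finally show ?thesis .
qed

section \<open>The functional on generators and on their multiples\<close>

lemma lookup_h_poly:
  "Poly_Mapping.lookup (h_poly d m) \<alpha> = (if in_vars m \<alpha> \<and> mdeg \<alpha> = d then 1 else 0)"
  unfolding h_poly_def lookup_sum by (simp add: lookup_single when_def finite_monomials)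

lemma lookup_e_poly:
  "Poly_Mapping.lookup (e_poly d m) \<alpha> = (if in_vars m \<alpha> \<and> mdeg \<alpha> = d \<and> sqfree_mon \<alpha> then 1 else 0)"
proof -
  have "finite {\<alpha>. in_vars m \<alpha> \<and> mdeg \<alpha> = d \<and> sqfree_mon \<alpha>}"
    by (rule finite_subset[OF _ finite_monomials[of m d]]) auto
  then show ?thesis unfolding e_poly_def lookup_sum by (simp add: lookup_single when_def)
qed

lemma moment_sum:
  "(\<Sum>\<alpha>\<in>A. moment n k c \<alpha>) = (\<Sum>ys\<in>label_lists k n {}. c ys * (\<Sum>\<alpha>\<in>A. meval n (point ys) \<alpha>))"
  unfolding moment_def sum_distrib_left by (rule sum.swap)

lemma moment_sum_hsym:
  assumes "i \<le> n"
  shows "(\<Sum>\<alpha> | in_vars i \<alpha> \<and> mdeg \<alpha> = d. moment n k c \<alpha>) =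
    (\<Sum>ys\<in>label_lists k n {}. c ys * hsym (point ys) {1..i} d)"
proof -
  have "(\<Sum>\<alpha> | in_vars i \<alpha> \<and> mdeg \<alpha> = d. meval n x \<alpha>) = hsym x {1..i} d" for x :: "nat \<Rightarrow> 'a poly"
    unfolding sum_meval_eq_hsym[symmetric] using assms by (intro sum.cong) (auto simp: meval_mono)
  then show ?thesis unfolding moment_sum by simp
qed

lemma moment_sum_esym:
  "(\<Sum>\<alpha> | in_vars n \<alpha> \<and> mdeg \<alpha> = d \<and> sqfree_mon \<alpha>. moment n k c \<alpha>) =
    (\<Sum>ys\<in>label_lists k n {}. c ys * ((-1) ^ d * esym (point ys) {1..n} d))"
  unfolding moment_sum sum_sqfree_meval_eq_esym ..

lemma graded_moment_h_poly:
  assumes "i \<in> {1..n}" "1 \<le> k"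
    and low: "\<And>\<alpha>. in_vars n \<alpha> \<Longrightarrow> mdeg \<alpha> < d \<Longrightarrow> moment n k c \<alpha> = 0"
  shows "graded_moment n k c d (h_poly k i) = 0"
proof (cases "d = k")
  case False
  then show ?thesis by (simp add: graded_moment_def lookup_h_poly)
next
  case True
  let ?L = "label_lists k n {}"
  have i: "1 \<le> i" "i \<le> n" using assms(1) by auto
  have "graded_moment n k c d (h_poly k i) = (\<Sum>\<alpha> | in_vars i \<alpha> \<and> mdeg \<alpha> = k. moment n k c \<alpha>)"
    unfolding graded_moment_def True using i
    by (intro sum.mono_neutral_cong_right) (auto simp: lookup_h_poly finite_monomials pCons_one elim: in_vars_mono)
  also have "\<dots> = (\<Sum>ys\<in>?L. c ys * hsym (point ys) {1..i} k)"
    using i by (intro moment_sum_hsym)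
  \<comment> \<open>At each point the relation replaces h_k by terms of lower degree, whose moments
    vanish by \<open>low\<close>.\<close>
  also have "\<dots> = - (\<Sum>ys\<in>?L. c ys * (\<Sum>j\<in>{..k} - {0}. esym node {..<k + i - 1} j * hsym (point ys) {1..i} (k - j)))"
  proof -
    have "hsym (point ys) {1..i} k = - (\<Sum>j\<in>{..k} - {0}. esym node {..<k + i - 1} j * hsym (point ys) {1..i} (k - j) :: 'a poly)"
      if "ys \<in> ?L" for ys
      using hsym_point_relation[OF that i assms(2), where 'a = 'a]
      by (subst (asm) sum.remove[of _ 0]) (auto simp: eq_neg_iff_add_eq_0)
    then show ?thesis by (simp add: sum_negf)
  qed
  also have "(\<Sum>ys\<in>?L. c ys * (\<Sum>j\<in>{..k} - {0}. esym node {..<k + i - 1} j * hsym (point ys) {1..i} (k - j))) =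
      (\<Sum>j\<in>{..k} - {0}. esym node {..<k + i - 1} j * (\<Sum>ys\<in>?L. c ys * hsym (point ys) {1..i} (k - j)))"
    unfolding sum_distrib_left by (subst sum.swap) (simp add: mult_ac)
  also have "\<dots> = 0"
  proof (rule sum.neutral, rule ballI)
    fix j assume j: "j \<in> {..k} - {0}"
    have "(\<Sum>ys\<in>?L. c ys * hsym (point ys) {1..i} (k - j)) = (\<Sum>\<alpha> | in_vars i \<alpha> \<and> mdeg \<alpha> = k - j. moment n k c \<alpha>)"
      by (rule moment_sum_hsym[OF i(2), symmetric])
    also have "\<dots> = 0"
      using j True i assms(2) by (intro sum.neutral) (auto intro!: low elim: in_vars_mono)
    finally show "esym node {..<k + i - 1} j * (\<Sum>ys\<in>?L. c ys * hsym (point ys) {1..i} (k - j)) = 0" by simp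
  qed
  finally show ?thesis by simp
qed

lemma graded_moment_e_poly:
  assumes e: "e \<in> {n - k + 1..n}"
    and low: "\<And>\<alpha>. in_vars n \<alpha> \<Longrightarrow> mdeg \<alpha> < d \<Longrightarrow> moment n k c \<alpha> = 0"
  shows "graded_moment n k c d (e_poly e n) = 0"
proof (cases "d = e")
  case False
  then show ?thesis by (simp add: graded_moment_def lookup_e_poly)
next
  case True
  let ?L = "label_lists k n {}"
  have gt: "n - k < e" using e by simp
  have "graded_moment n k c d (e_poly e n) = (\<Sum>\<alpha> | in_vars n \<alpha> \<and> mdeg \<alpha> = e \<and> sqfree_mon \<alpha>. moment n k c \<alpha>)"
    unfolding graded_moment_def True
    by (intro sum.mono_neutral_cong_right) (auto simp: lookup_e_poly finite_monomials pCons_one)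
  also have "\<dots> = (\<Sum>ys\<in>?L. c ys * ((-1) ^ e * esym (point ys) {1..n} e))"
    by (rule moment_sum_esym)
  also have "\<dots> = - (\<Sum>ys\<in>?L. c ys * ((-1) ^ e * (\<Sum>j\<in>{..e} - {e}. esym (point ys) {1..n} j * hsym node {..<k} (e - j))))"
  proof -
    have "esym (point ys) {1..n} e = - (\<Sum>j\<in>{..e} - {e}. esym (point ys) {1..n} j * hsym node {..<k} (e - j) :: 'a poly)"
      if "ys \<in> ?L" for ys
      using esym_point_relation[OF that gt, where 'a = 'a]
      by (subst (asm) sum.remove[of _ e]) (auto simp: eq_neg_iff_add_eq_0)
    then show ?thesis by (simp add: sum_negf)
  qed
  \<comment> \<open>The sign is redistributed so that the inner sum contains the unsigned e_j, which
    is a sum of moments of degree j < d.\<close>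
  also have "(\<Sum>ys\<in>?L. c ys * ((-1) ^ e * (\<Sum>j\<in>{..e} - {e}. esym (point ys) {1..n} j * hsym node {..<k} (e - j)))) =
      (\<Sum>j\<in>{..e} - {e}. (-1) ^ (e + j) * hsym node {..<k} (e - j) *
         (\<Sum>ys\<in>?L. c ys * ((-1) ^ j * esym (point ys) {1..n} j)))"
    unfolding sum_distrib_left by (subst sum.swap) (simp add: mult_ac power_add)
  also have "\<dots> = 0"
  proof (rule sum.neutral, rule ballI)
    fix j assume j: "j \<in> {..e} - {e}"
    have "(\<Sum>ys\<in>?L. c ys * ((-1) ^ j * esym (point ys) {1..n} j)) =
        (\<Sum>\<alpha> | in_vars n \<alpha> \<and> mdeg \<alpha> = j \<and> sqfree_mon \<alpha>. moment n k c \<alpha>)"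
      by (rule moment_sum_esym[symmetric])
    also have "\<dots> = 0"
      using j True by (intro sum.neutral) (auto intro!: low)
    finally show "(-1) ^ (e + j) * hsym node {..<k} (e - j) *
         (\<Sum>ys\<in>?L. c ys * ((-1) ^ j * esym (point ys) {1..n} j)) = 0" by simp
  qed
  finally show ?thesis by simp
qed

lemma lookup_single_mult_add:
  "Poly_Mapping.lookup (Poly_Mapping.single (\<beta> :: mon) s * f) (\<beta> + \<alpha>) = s * Poly_Mapping.lookup f \<alpha>"
proof -
  have "Poly_Mapping.single \<beta> s * f = (\<Sum>\<gamma>\<in>Poly_Mapping.keys f. Poly_Mapping.single (\<beta> + \<gamma>) (s * Poly_Mapping.lookup f \<gamma>))"
    by (subst (1) poly_mapping_sum_singles[of f, symmetric]) (simp add: sum_distrib_left mult_single)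
  then show ?thesis
    by (simp add: lookup_sum lookup_single when_def in_keys_iff)
qed

text \<open>Multiplication by a monomial is absorbed into the weights, at the price of a degree
  shift.\<close>

lemma graded_moment_single_mult:
  assumes b: "in_vars n \<beta>"
  shows "graded_moment n k c d (Poly_Mapping.single \<beta> s * f) =
    (if mdeg \<beta> \<le> d then [:s:] * graded_moment n k (\<lambda>ys. c ys * meval n (point ys) \<beta>) (d - mdeg \<beta>) f else 0)"
proof -
  let ?B = "\<lambda>d. {\<alpha>. in_vars n \<alpha> \<and> mdeg \<alpha> = d}"
  let ?g = "Poly_Mapping.single \<beta> s * f"
  have zero: "Poly_Mapping.lookup ?g \<alpha> = 0" if "\<alpha> \<notin> range ((+) \<beta>)" for \<alpha>
  proof (rule ccontr)
    assume "Poly_Mapping.lookup ?g \<alpha> \<noteq> 0"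
    then have "\<alpha> \<in> Poly_Mapping.keys ?g" by (simp add: in_keys_iff)
    then obtain \<gamma> where "\<alpha> = \<beta> + \<gamma>"
      using keys_mult[of "Poly_Mapping.single \<beta> s" f] by (auto split: if_splits)
    with that show False by auto
  qed
  show ?thesis
  proof (cases "mdeg \<beta> \<le> d")
    case False
    then have "?B d \<inter> range ((+) \<beta>) = {}" by (auto simp: mdeg_add)
    then have "Poly_Mapping.lookup ?g \<alpha> = 0" if "\<alpha> \<in> ?B d" for \<alpha> using that zero by blast
    then show ?thesis using False by (simp add: graded_moment_def)
  next
    case True
    have "graded_moment n k c d ?g =
       (\<Sum>\<alpha>\<in>(+) \<beta> ` ?B (d - mdeg \<beta>). [:Poly_Mapping.lookup ?g \<alpha>:] * moment n k c \<alpha>)"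
      unfolding graded_moment_def
    proof (rule sum.mono_neutral_right)
      show "\<forall>\<alpha>\<in>?B d - (+) \<beta> ` ?B (d - mdeg \<beta>). [:Poly_Mapping.lookup ?g \<alpha>:] * moment n k c \<alpha> = 0"
      proof
        fix \<alpha> assume \<alpha>: "\<alpha> \<in> ?B d - (+) \<beta> ` ?B (d - mdeg \<beta>)"
        have "\<alpha> \<notin> range ((+) \<beta>)" using \<alpha> by (auto simp: mdeg_add)
        then show "[:Poly_Mapping.lookup ?g \<alpha>:] * moment n k c \<alpha> = 0" using zero by simp
      qed
    qed (use True b in \<open>auto simp: mdeg_add finite_monomials\<close>)
    also have "\<dots> = (\<Sum>\<alpha>\<in>?B (d - mdeg \<beta>). [:Poly_Mapping.lookup ?g (\<beta> + \<alpha>):] * moment n k c (\<beta> + \<alpha>))"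
      by (subst sum.reindex) auto
    also have "\<dots> = [:s:] * graded_moment n k (\<lambda>ys. c ys * meval n (point ys) \<beta>) (d - mdeg \<beta>) f"
      unfolding graded_moment_def sum_distrib_left lookup_single_mult_add
      by (intro sum.cong) (auto simp: moment_def meval_add mult_ac)
    finally show ?thesis using True by simp
  qed
qed

lemma graded_moment_add:
  "graded_moment n k c d (f + g) = graded_moment n k c d f + graded_moment n k c d g"
  by (simp add: graded_moment_def lookup_add smult_add_left sum.distrib)

lemma graded_moment_0 [simp]: "graded_moment n k c d 0 = 0"
  by (simp add: graded_moment_def)

lemma graded_moment_sum: "graded_moment n k c d (sum f A) = (\<Sum>a\<in>A. graded_moment n k c d (f a))"
  by (induction A rule: infinite_finite_induct) (simp_all add: graded_moment_add)

text \<open>On $J_{n,k}$, the homogeneous component of lowest degree in which the functional can act is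
  annihilated. The statement has to be proved for all weights $c$ at once, since multiplication by a
  monomial changes the weights.\<close>

lemma graded_moment_J_ideal:
  assumes "1 \<le> k" "f \<in> J_ideal n k"
    and "\<And>\<alpha>. in_vars n \<alpha> \<Longrightarrow> mdeg \<alpha> < d \<Longrightarrow> moment n k c \<alpha> = 0"
  shows "graded_moment n k c d f = 0"
  using assms(2,3) unfolding J_ideal_def
proof (induction f arbitrary: c d rule: ideal_gen.induct)
  case (gen g)
  then show ?case using graded_moment_h_poly[of _ n k d c] graded_moment_e_poly[of _ n k d c] assms(1) by blast
next
  case (add f g)
  then show ?case by (simp add: graded_moment_add)
next
  case (mult q f)
  have "q * f = (\<Sum>\<beta>\<in>Poly_Mapping.keys q. Poly_Mapping.single \<beta> (Poly_Mapping.lookup q \<beta>) * f)"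
    by (subst (1) poly_mapping_sum_singles[of q, symmetric]) (simp add: sum_distrib_right)
  moreover have "graded_moment n k c d (Poly_Mapping.single \<beta> (Poly_Mapping.lookup q \<beta>) * f) = 0"
    if "\<beta> \<in> Poly_Mapping.keys q" for \<beta>
  proof -
    have b: "in_vars n \<beta>" using that mult.hyps(1) by (simp add: poly_ring_def)
    have "graded_moment n k (\<lambda>ys. c ys * meval n (point ys) \<beta>) (d - mdeg \<beta>) f = 0" if "mdeg \<beta> \<le> d"
    proof (rule mult.IH)
      fix \<alpha> assume "in_vars n \<alpha>" "mdeg \<alpha> < d - mdeg \<beta>"
      then have "moment n k c (\<beta> + \<alpha>) = 0" using b that by (intro mult.prems) (auto simp: mdeg_add)
      then show "moment n k (\<lambda>ys. c ys * meval n (point ys) \<beta>) \<alpha> = 0"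
        by (simp add: moment_def meval_add mult_ac)
    qed
    then show ?thesis unfolding graded_moment_single_mult[OF b] by simp
  qed
  ultimately show ?case by (simp add: graded_moment_sum)
qed simp

text \<open>The product of all x_i - \<open>node l\<close>, with \<open>l\<close> ranging over the
  labels that \<open>y\<close> does not have at place i, vanishes at every point except
  \<open>y\<close>.\<close>

lemma moments_determine_weights:
  assumes 0: "\<And>\<alpha>. in_vars n \<alpha> \<Longrightarrow> moment n k c \<alpha> = 0" and y: "y \<in> label_lists k n {}"
  shows "c y = (0 :: ('a::field) poly)"
proof -
  let ?L = "label_lists k n {}"
  \<comment> \<open>Expanding one factor produces a further variable, so the claim is made for all
    monomials times a partial product.\<close>
  have prod0: "(\<Sum>ys\<in>?L. c ys * meval n (point ys) \<alpha> * (\<Prod>(i, l)\<in>T. point ys i - node l)) = 0"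
    if "finite T" "T \<subseteq> {1..n} \<times> UNIV" "in_vars n \<alpha>" for T \<alpha>
    using that
  proof (induction T arbitrary: \<alpha> rule: finite_induct)
    case empty
    then show ?case using 0[of \<alpha>] by (simp add: moment_def)
  next
    case (insert t T)
    obtain i l where t: "t = (i, l)" "i \<in> {1..n}" using insert.prems by (cases t) auto
    let ?P = "\<lambda>ys. \<Prod>(i, l)\<in>T. point ys i - node l"
    have "in_vars n (\<alpha> + Poly_Mapping.single i 1)"
      unfolding in_vars_add using t(2) insert.prems by (simp add: in_vars_def)
    then have 1: "(\<Sum>ys\<in>?L. c ys * meval n (point ys) (\<alpha> + Poly_Mapping.single i 1) * ?P ys) = 0"
      using insert.prems by (intro insert.IH) auto
    have 2: "(\<Sum>ys\<in>?L. c ys * meval n (point ys) \<alpha> * ?P ys) = 0"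
      using insert.prems by (intro insert.IH) auto
    have "(\<Sum>ys\<in>?L. c ys * meval n (point ys) \<alpha> * (\<Prod>(i, l)\<in>insert t T. point ys i - node l)) =
      (\<Sum>ys\<in>?L. c ys * meval n (point ys) (\<alpha> + Poly_Mapping.single i 1) * ?P ys)
       - node l * (\<Sum>ys\<in>?L. c ys * meval n (point ys) \<alpha> * ?P ys)"
      unfolding sum_distrib_left sum_subtractf[symmetric] using t insert.hyps
      by (intro sum.cong) (auto simp: meval_add meval_single algebra_simps)
    then show ?case unfolding 1 2 by simp
  qed
  \<comment> \<open>All labels are below k + n, so every wrong label at every place is
    covered.\<close>
  define T where "T = {(i, l). i \<in> {1..n} \<and> l < k + n \<and> l \<noteq> y ! (i - 1)}"
  have "T \<subseteq> {1..n} \<times> {..<k + n}" by (auto simp: T_def)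
  then have fin: "finite T" by (rule finite_subset) simp
  let ?P = "\<lambda>ys. \<Prod>(i, l)\<in>T. point ys i - node l :: 'a poly"
  have "(\<Sum>ys\<in>?L. c ys * meval n (point ys) 0 * ?P ys) = 0"
    using fin by (intro prod0) (auto simp: T_def)
  moreover have "?P ys = 0" if ys: "ys \<in> ?L" "ys \<noteq> y" for ys
  proof -
    have "length ys = n" "length y = n" using ys y by (auto simp: label_lists_def)
    then obtain j where j: "j < n" "ys ! j \<noteq> y ! j" using ys(2) by (metis nth_equalityI)
    have "ys ! j < k + n"
      using valid_labels_props(4)[of "{}" k ys j] ys j by (auto simp: label_lists_def)
    then have "(Suc j, ys ! j) \<in> T" using j by (simp add: T_def)
    moreover have "point ys (Suc j) - node (ys ! j) = (0 :: 'a poly)" by (simp add: point_def)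
    ultimately show ?thesis using fin by (intro prod_zero bexI[of _ "(Suc j, ys ! j)"]) auto
  qed
  ultimately have "c y * ?P y = 0"
    using sum.remove[OF finite_label_lists y, of "\<lambda>ys. c ys * meval n (point ys) 0 * ?P ys"] by simp
  moreover have "point y i - node l \<noteq> (0 :: 'a poly)" if "(i, l) \<in> T" for i l
    using that by (auto simp: T_def point_def inj_eq[OF inj_node])
  then have "?P y \<noteq> 0" using fin by (auto simp: prod_zero_iff)
  ultimately show ?thesis by simp
qed

text \<open>\<open>M\<close> is the set of candidates, and \<open>cover\<close> provides a leading
  monomial dividing each monomial outside it. If \<open>lm f\<close> were a candidate as well, it
  would impose no equation of its own, which leaves fewer equations than points.\<close>

lemma leading_monomial_not_standard:
  fixes f :: "('a::field) mpoly"
  assumes k: "1 \<le> k" and M: "finite M" "card M \<le> card (label_lists k n {})"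
    and cover: "\<And>\<alpha>. in_vars n \<alpha> \<Longrightarrow> \<alpha> \<notin> M \<Longrightarrow>
      \<exists>g \<beta>. g \<in> (J_ideal n k :: 'a mpoly set) \<and> g \<noteq> 0 \<and> \<alpha> = \<beta> + lm g"
    and f: "f \<in> J_ideal n k" "f \<noteq> 0"
  shows "lm f \<notin> M"
proof
  assume lm: "lm f \<in> M"
  let ?L = "label_lists k n {}"
  let ?M = "M - {lm f}"
  have "card ?M < card M" using M(1) lm by (rule card_Diff1_less)
  then have "card ?M < card ?L" using M by simp
  then obtain c where c: "\<exists>ys\<in>?L. c ys \<noteq> 0"
      "\<forall>\<alpha>\<in>?M. (\<Sum>ys\<in>?L. c ys * meval n (point ys :: nat \<Rightarrow> 'a poly) \<alpha>) = 0"
    using homogeneous_system_nontrivial[of ?M ?L "\<lambda>\<alpha> ys. meval n (point ys :: nat \<Rightarrow> 'a poly) \<alpha>"] M(1) finite_label_lists by auto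
  have "moment n k c \<alpha> = 0" if "in_vars n \<alpha>" "mdeg \<alpha> = d" for \<alpha> d
    using that
  proof (induction d arbitrary: \<alpha> rule: less_induct)
    case (less d)
    show ?case
    proof (rule ccontr)
      assume "moment n k c \<alpha> \<noteq> 0"
      let ?Z = "{\<alpha>. in_vars n \<alpha> \<and> mdeg \<alpha> = d \<and> moment n k c \<alpha> \<noteq> 0}"
      have "?Z \<noteq> {}" using less.prems \<open>moment n k c \<alpha> \<noteq> 0\<close> by auto
      moreover have "finite ?Z" by (rule finite_subset[OF _ finite_monomials[of n d]]) auto
      \<comment> \<open>A smallest monomial of degree d on which the functional is nonzero. It
        avoids \<open>?M\<close>, so it is a multiple of a leading monomial from the ideal, possibly
        of \<open>lm f\<close> itself.\<close>
      ultimately obtain \<mu> where \<mu>: "\<mu> \<in> ?Z" "\<forall>\<alpha>\<in>?Z. \<alpha> \<noteq> \<mu> \<longrightarrow> \<not> neglex_less \<alpha> \<mu>"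
        using Finite_Set.bex_min_element[of ?Z neglex_less] neglex_less_trans neglex_less_irrefl
        by (metis (no_types, lifting) asymp_onI transp_onI)
      have "\<mu> \<notin> ?M" using \<mu>(1) c(2) by (auto simp: moment_def)
      have "\<exists>g \<beta>. g \<in> J_ideal n k \<and> (g :: 'a mpoly) \<noteq> 0 \<and> \<mu> = \<beta> + lm g"
      proof (cases "\<mu> = lm f")
        case True
        then show ?thesis using f by (intro exI[of _ f] exI[of _ 0]) simp
      next
        case False
        then show ?thesis using cover[of \<mu>] \<mu>(1) \<open>\<mu> \<notin> ?M\<close> by auto
      qed
      then obtain g \<beta> where g: "g \<in> J_ideal n k" "(g :: 'a mpoly) \<noteq> 0" "\<mu> = \<beta> + lm g" by blast
      let ?g = "Poly_Mapping.single \<beta> 1 * g"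
      have "in_vars n \<beta>" using \<mu>(1) g(3) by simp
      then have "?g \<in> J_ideal n k"
        using g(1) unfolding J_ideal_def by (intro ideal_gen.mult poly_ring_single)
      then have 0: "graded_moment n k c d ?g = 0"
        by (rule graded_moment_J_ideal[OF k]) (use less.IH in blast)
      have above: "Poly_Mapping.lookup ?g \<alpha> = 0" if "neglex_less \<mu> \<alpha>" for \<alpha>
      proof (rule ccontr)
        assume "Poly_Mapping.lookup ?g \<alpha> \<noteq> 0"
        then have "\<alpha> \<in> Poly_Mapping.keys ?g" by (simp add: in_keys_iff)
        then obtain \<gamma> where \<gamma>: "\<alpha> = \<beta> + \<gamma>" "\<gamma> \<in> Poly_Mapping.keys g"
          using keys_mult[of "Poly_Mapping.single \<beta> 1" g] by auto
        have "neglex_le \<alpha> \<mu>" unfolding \<gamma>(1) g(3)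
          using lm_max(2)[OF g(2) \<gamma>(2)] by (auto simp: neglex_le_iff intro: neglex_less_add_left)
        then show False using that neglex_less_trans[of \<mu> \<alpha> \<mu>] by (auto simp: neglex_le_iff)
      qed
      \<comment> \<open>Above \<mu> the coefficients of \<open>?g\<close> vanish, below \<mu> the
        moments do by minimality. The polynomial may be inhomogeneous: only its component of degree
        d enters, and \<mu> belongs to it.\<close>
      have "graded_moment n k c d ?g = [:Poly_Mapping.lookup ?g \<mu>:] * moment n k c \<mu>"
        unfolding graded_moment_def
      proof (subst sum.remove[of _ \<mu>])
        have "[:Poly_Mapping.lookup ?g \<alpha>:] * moment n k c \<alpha> = 0"
          if "\<alpha> \<in> {\<alpha>. in_vars n \<alpha> \<and> mdeg \<alpha> = d} - {\<mu>}" for \<alpha>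
        proof (cases "moment n k c \<alpha> = 0")
          case False
          then have "neglex_less \<mu> \<alpha>" using that \<mu>(2) neglex_less_linear[of \<mu> \<alpha>] by auto
          then show ?thesis using above by simp
        qed simp
        then show "[:Poly_Mapping.lookup ?g \<mu>:] * moment n k c \<mu> +
          (\<Sum>\<alpha>\<in>{\<alpha>. in_vars n \<alpha> \<and> mdeg \<alpha> = d} - {\<mu>}. [:Poly_Mapping.lookup ?g \<alpha>:] * moment n k c \<alpha>) =
          [:Poly_Mapping.lookup ?g \<mu>:] * moment n k c \<mu>" by (simp add: sum.neutral)
      qed (use \<mu>(1) in \<open>auto simp: finite_monomials\<close>)
      moreover have "Poly_Mapping.lookup ?g \<mu> \<noteq> 0"
        unfolding g(3) lookup_single_mult_add using lm_max(1)[OF g(2)] by (simp add: in_keys_iff)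
      ultimately have "moment n k c \<mu> = 0" using 0 by simp
      with \<mu>(1) show False by simp
    qed
  qed
  then have "\<forall>ys\<in>?L. c ys = 0" using moments_determine_weights[of n k c] by blast
  with c(1) show False by blast
qed

section \<open>The Groebner basis\<close>

lemma strict_mono_on_add_diff:
  assumes "strict_mono_on {..<m} (p :: nat \<Rightarrow> nat)" "a \<le> b" "b < m"
  shows "p a + (b - a) \<le> p b"
  using assms(2,3)
proof (induction b rule: dec_induct)
  case (step b)
  have "p b < p (Suc b)" using assms(1) step.prems by (auto simp: strict_mono_on_def)
  then show ?case using step by simp
qed simp

lemma length_gammaS [simp]: "length (gammaS n S) = n"
  by (simp add: gammaS_def)

lemma nth_rev_gammaS:
  assumes "j < n"
  shows "rev (gammaS n S) ! j = (if n - j \<in> S then n - j - card {t \<in> S. t \<le> n - j} + 1 else 0)"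
proof -
  have "n - Suc j < n" "n - Suc j + 1 = n - j" using assms by auto
  moreover from this have "rev (gammaS n S) ! j = gammaS n S ! (n - Suc j)"
    using assms by (simp add: rev_nth)
  ultimately show ?thesis by (simp add: gammaS_def)
qed

text \<open>Position p_a comes from s = n + 1 - p_a, an element of rank m - a in S, where m = n - k
  + 1. Its part s - (m - a) + 1 is therefore k + 1 + a - p_a, and these parts decrease weakly
  because \<open>p\<close> increases strictly.\<close>

lemma gammaS_flag_rep:
  assumes k: "1 \<le> k" "k \<le> n" and S: "S \<subseteq> {1..n - 1}" "card S = n - k + 1"
  obtains p where "flag_rep (rev (gammaS n S)) (n - k + 1) p (\<lambda>a. k + 1 + a - p a)"
    "\<And>a. a < n - k + 1 \<Longrightarrow> 1 \<le> p a \<and> p a \<le> n \<and> p a \<le> k + a"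
proof -
  define m where "m = n - k + 1"
  have finS: "finite S" using S(1) finite_subset by blast
  let ?r = "\<lambda>s. n + 1 - s"
  define P where "P = ?r ` S"
  define xs where "xs = sorted_list_of_set P"
  define p where "p a = xs ! a" for a
  have Sle: "s \<le> n" if "s \<in> S" for s using subsetD[OF S(1) that] by auto
  have injr: "inj_on ?r S"
  proof (rule inj_onI)
    fix x y assume xy: "x \<in> S" "y \<in> S" "?r x = ?r y"
    then have "x \<le> n" "y \<le> n" using Sle by blast+
    then show "x = y" using xy(3) by simp
  qed
  have finP: "finite P" by (simp add: P_def finS)
  have cardP: "card P = m" by (simp only: P_def card_image[OF injr] S(2) m_def)
  have xs: "set xs = P" "length xs = m" "sorted_wrt (<) xs"
    using finP cardP by (auto simp: xs_def)
  have mono: "strict_mono_on {..<m} p"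
    using xs by (auto simp: strict_mono_on_def p_def sorted_wrt_iff_nth_less)
  have inj: "inj_on p {..<m}" using mono by (rule strict_mono_on_imp_inj_on)
  have P: "P = p ` {..<m}" using xs by (auto simp: p_def set_conv_nth)
  have P2: "P \<subseteq> {2..n}"
  proof
    fix x assume "x \<in> P"
    then obtain s where s: "s \<in> S" "x = ?r s" by (auto simp: P_def)
    then have "s \<in> {1..n - 1}" using S(1) by blast
    then show "x \<in> {2..n}" using s by auto
  qed
  have pin: "p a \<in> P" if "a < m" for a using that P by auto
  have le_n: "1 \<le> p a" "p a \<le> n" if "a < m" for a using pin[OF that] P2 by auto
  \<comment> \<open>The m - 1 - a later positions must still fit into {1..n}.\<close>
  have le: "p a \<le> k + a" if "a < m" for a
  proof -
    have "p a + (m - 1 - a) \<le> p (m - 1)" using that by (intro strict_mono_on_add_diff[OF mono]) auto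
    then show ?thesis using le_n(2)[of "m - 1"] that k by (auto simp: m_def)
  qed
  have count: "card {t \<in> S. t \<le> ?r (p a)} = m - a" if a: "a < m" for a
  proof -
    have sub: "{t \<in> S. t \<le> ?r (p a)} \<subseteq> S" by auto
    have "?r ` {t \<in> S. t \<le> ?r (p a)} = p ` {a..<m}"
    proof (intro equalityI subsetI)
      fix x assume "x \<in> ?r ` {t \<in> S. t \<le> ?r (p a)}"
      then obtain t where t: "t \<in> S" "t \<le> ?r (p a)" "x = ?r t" by auto
      then have "x \<in> P" "p a \<le> x" using le_n[OF a] by (auto simp: P_def)
      then obtain b where b: "b < m" "x = p b" using P by auto
      have "a \<le> b"
      proof (rule ccontr)
        assume "\<not> a \<le> b"
        then have "p b < p a" using mono a by (auto simp: strict_mono_on_def)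
        then show False using \<open>p a \<le> x\<close> b by simp
      qed
      then show "x \<in> p ` {a..<m}" using b by auto
    next
      fix x assume "x \<in> p ` {a..<m}"
      then obtain b where b: "a \<le> b" "b < m" "x = p b" by auto
      have ge: "p a \<le> p b" using strict_mono_on_add_diff[OF mono b(1,2)] by simp
      obtain s where s: "s \<in> S" "p b = ?r s" using pin[OF b(2)] by (auto simp: P_def)
      then have "s \<le> ?r (p a)" using ge Sle[OF s(1)] by simp
      then show "x \<in> ?r ` {t \<in> S. t \<le> ?r (p a)}" using s b by auto
    qed
    then have "card (p ` {a..<m}) = card {t \<in> S. t \<le> ?r (p a)}"
      using card_image[OF inj_on_subset[OF injr sub]] by simp
    moreover have "{a..<m} \<subseteq> {..<m}" by auto
    ultimately show ?thesis using card_image[OF inj_on_subset[OF inj]] by simp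
  qed
  have "flag_rep (rev (gammaS n S)) m p (\<lambda>a. k + 1 + a - p a)"
    unfolding flag_rep_def
  proof (intro conjI allI impI)
    fix a assume a: "a < m"
    show "1 \<le> p a" "p a \<le> length (rev (gammaS n S))" using le_n[OF a] by auto
    show "0 < k + 1 + a - p a" using le[OF a] by simp
    have "n - (p a - 1) = ?r (p a)" using le_n[OF a] by simp
    moreover obtain s where s: "s \<in> S" "p a = ?r s" using pin[OF a] by (auto simp: P_def)
    then have "?r (p a) = s" using Sle[OF s(1)] by simp
    then have "?r (p a) \<in> S" using s by simp
    ultimately have "rev (gammaS n S) ! (p a - 1) = ?r (p a) - (m - a) + 1"
      using nth_rev_gammaS[of "p a - 1" n S] count[OF a] le_n[OF a] by simp
    also have "\<dots> = k + 1 + a - p a" using le[OF a] le_n[OF a] a k by (auto simp: m_def)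
    finally show "rev (gammaS n S) ! (p a - 1) = k + 1 + a - p a" .
  next
    fix j assume j: "j < length (rev (gammaS n S))" "rev (gammaS n S) ! j \<noteq> 0"
    then have "n - j \<in> S" using nth_rev_gammaS[of j n S] by (auto split: if_splits)
    then have "?r (n - j) \<in> P" by (auto simp: P_def)
    then show "\<exists>a<m. p a = j + 1" using j P by auto
  next
    fix a b assume ab: "a < b" "b < m"
    show "p a < p b" using mono ab by (auto simp: strict_mono_on_def)
    show "k + 1 + b - p b \<le> k + 1 + a - p a"
      using strict_mono_on_add_diff[OF mono, of a b] ab by simp
  qed
  then show ?thesis using that le_n le unfolding m_def by blast
qed

definition gamma_mon :: "nat \<Rightarrow> nat set \<Rightarrow> mon" where
  "gamma_mon n S = (\<Sum>j<n. Poly_Mapping.single (j + 1) (rev (gammaS n S) ! j))"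

lemma lookup_gamma_mon:
  "Poly_Mapping.lookup (gamma_mon n S) i =
    (if i \<in> {1..n} \<and> n + 1 - i \<in> S then n + 1 - i - card {t \<in> S. t \<le> n + 1 - i} + 1 else 0)"
proof -
  have inj: "inj_on (\<lambda>j. j + 1) {..<n}" by simp
  show ?thesis
  proof (cases "i \<in> {1..n}")
    case True
    then have i: "i - 1 < n" "i = i - 1 + 1" "n - (i - 1) = n + 1 - i" by auto
    then have "Poly_Mapping.lookup (gamma_mon n S) i = rev (gammaS n S) ! (i - 1)"
      using lookup_sum_single(1)[OF inj, of "i - 1" "\<lambda>j. rev (gammaS n S) ! j"] by (simp add: gamma_mon_def)
    then show ?thesis using nth_rev_gammaS[OF i(1), of S] i(3) True by simp
  next
    case False
    then have "i \<notin> (\<lambda>j. j + 1) ` {..<n}" by auto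
    then show ?thesis using lookup_sum_single(2)[OF inj, of i] False by (auto simp: gamma_mon_def)
  qed
qed

lemma kappa_gammaS:
  assumes "1 \<le> k" "k \<le> n" "S \<subseteq> {1..n - 1}" "card S = n - k + 1"
  shows "(kappa (rev (gammaS n S)) :: ('a::field) mpoly) \<in> J_ideal n k"
    and "monic_lead (kappa (rev (gammaS n S)) :: ('a::field) mpoly) (gamma_mon n S)"
proof -
  obtain p where p: "flag_rep (rev (gammaS n S)) (n - k + 1) p (\<lambda>a. k + 1 + a - p a)"
      "\<And>a. a < n - k + 1 \<Longrightarrow> 1 \<le> p a \<and> p a \<le> n \<and> p a \<le> k + a"
    using gammaS_flag_rep[OF assms] by blast
  note kappa = kappa_eq_flagged_schur[OF p(1), where 'a = 'a]
  show "(kappa (rev (gammaS n S)) :: 'a mpoly) \<in> J_ideal n k"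
    unfolding kappa using p(2) by (intro flagged_schur_in_J_ideal assms refl) auto
  have mon: "gamma_mon n S = (\<Sum>a<n - k + 1. Poly_Mapping.single (p a) (k + 1 + a - p a))"
    using flag_rep_monomial[OF p(1)] by (simp add: gamma_mon_def)
  show "monic_lead (kappa (rev (gammaS n S)) :: 'a mpoly) (gamma_mon n S)"
    unfolding kappa mon using p(2) flag_rep_strict_mono[OF p(1)] by (intro monic_lead_flagged_schur) auto
qed

lemma monic_lead_h_poly: "1 \<le> i \<Longrightarrow> monic_lead (h_poly k i) (Poly_Mapping.single i k)"
  unfolding h_poly_eq_hsym by (rule monic_lead_hsym)

section \<open>Standard monomials and divisibility\<close>

lemma greedy_append: "greedy d (xs @ ys) = greedy (greedy d xs) ys"
  by (induction xs arbitrary: d) simp_all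

lemma greedy_take_Suc:
  "i < length bs \<Longrightarrow> greedy 0 (take (Suc i) bs) =
    (if bs ! i \<le> greedy 0 (take i bs) then Suc (greedy 0 (take i bs)) else greedy 0 (take i bs))"
  by (simp add: take_Suc_conv_app_nth greedy_append)

text \<open>The indices at which the greedy counter does not increase form the set of parts of some
  \<open>\<gamma>(S)\<close> dominated by the list; if the counter stays below \<open>k\<close>, there are enough of them.\<close>

lemma greedy_fails_imp_gammaS:
  assumes k: "1 \<le> k" "k \<le> n" and bs: "length bs = n" "\<And>i. i < n \<Longrightarrow> bs ! i < k" "greedy 0 bs < k"
  obtains S where "S \<subseteq> {1..n - 1}" "card S = n - k + 1"
    "\<And>s. s \<in> S \<Longrightarrow> s - card {t \<in> S. t \<le> s} + 1 \<le> bs ! (s - 1)"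
proof -
  define g where "g i = greedy 0 (take i bs)" for i
  define sel where "sel i = {j. j < i \<and> g j < bs ! j}" for i
  have fin: "finite (sel i)" for i
    by (rule finite_subset[of _ "{..<i}"]) (auto simp: sel_def)
  have sel_Suc: "sel (Suc i) = (if g i < bs ! i then insert i (sel i) else sel i)" for i
    by (auto simp: sel_def less_Suc_eq)
  have notin: "i \<notin> sel i" for i by (simp add: sel_def)
  have card_Suc: "card (sel (Suc i)) = (if g i < bs ! i then Suc (card (sel i)) else card (sel i))" for i
    using fin notin by (simp add: sel_Suc)
  \<comment> \<open>Each index is either selected or raises the counter. Hence, for a selected index
    i, the part that \<gamma>(S) has at i + 1 is g i + 1, and domination there means exactly
    \<open>g i < bs ! i\<close>.\<close>
  have total: "card (sel i) + g i = i" if "i \<le> n" for i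
    using that
  proof (induction i)
    case 0
    show ?case by (simp add: sel_def g_def)
  next
    case (Suc i)
    then show ?case using greedy_take_Suc[of i bs] bs(1) by (auto simp: card_Suc g_def[symmetric])
  qed
  define m where "m = n - k + 1"
  have "g n < k" using bs by (simp add: g_def)
  then have "m \<le> card (sel n)" using total[of n] k by (simp add: m_def)
  \<comment> \<open>Stopping as soon as \<open>m\<close> indices are selected makes S have exactly
    \<open>m\<close> elements.\<close>
  define t where "t = (LEAST t. m \<le> card (sel t))"
  have t: "m \<le> card (sel t)" unfolding t_def using \<open>m \<le> card (sel n)\<close> by (rule LeastI)
  have tn: "t \<le> n" unfolding t_def using \<open>m \<le> card (sel n)\<close> by (rule Least_le)
  have "card (sel 0) = 0" by (simp add: sel_def)
  then have "t \<noteq> 0" using t by (metis Suc_eq_plus1 m_def not_less_eq_eq zero_le)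
  then obtain t' where t': "t = Suc t'" by (cases t) auto
  then have "\<not> m \<le> card (sel t')" unfolding t_def using not_less_Least by (metis lessI)
  then have cardt: "card (sel t) = m" using t card_Suc[of t'] t' by (auto split: if_splits)
  define S where "S = Suc ` sel t"
  \<comment> \<open>Selecting the last index would force the counter to be k - 1 there and the entry
    to be at least k, which is excluded. Hence S avoids n.\<close>
  have "n - 1 \<notin> sel t"
  proof
    assume n1: "n - 1 \<in> sel t"
    then have "t = n" using tn by (auto simp: sel_def)
    then have gn: "g n = k - 1" using total[of n] cardt k by (simp add: m_def)
    have n: "Suc (n - 1) = n" using k by simp
    have "g (n - 1) < bs ! (n - 1)" using n1 by (simp add: sel_def)
    moreover from this have "g n = g (n - 1)"
      using greedy_take_Suc[of "n - 1" bs] bs(1) k n by (auto simp: g_def)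
    ultimately show False using gn bs(2)[of "n - 1"] k by simp
  qed
  moreover have "i < n" if "i \<in> sel t" for i using that tn by (auto simp: sel_def)
  ultimately have "Suc i \<le> n - 1" if "i \<in> sel t" for i
    using that by (metis Suc_diff_1 Suc_leI le_neq_implies_less less_Suc_eq_le bot_nat_0.not_eq_extremum not_less0)
  then have 1: "S \<subseteq> {1..n - 1}" by (auto simp: S_def)
  have 2: "card S = n - k + 1" using cardt by (simp add: S_def card_image m_def)
  have 3: "s - card {u \<in> S. u \<le> s} + 1 \<le> bs ! (s - 1)" if "s \<in> S" for s
  proof -
    obtain i where i: "s = Suc i" "i \<in> sel t" using \<open>s \<in> S\<close> by (auto simp: S_def)
    then have it: "i < t" "g i < bs ! i" by (auto simp: sel_def)
    have "{u \<in> S. u \<le> s} = Suc ` sel (Suc i)" using i it by (auto simp: S_def sel_def)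
    then have "card {u \<in> S. u \<le> s} = Suc (card (sel i))" using it by (simp add: card_image card_Suc)
    then show ?thesis using total[of i] it tn i by simp
  qed
  show ?thesis using that 1 2 3 by blast
qed

text \<open>Entry s - 1 belongs to x_{n+1-s}, the variable that carries the part of s after reversal
  of \<gamma>(S).\<close>

definition rev_exponents :: "nat \<Rightarrow> mon \<Rightarrow> nat list" where
  "rev_exponents n \<alpha> = map (\<lambda>i. Poly_Mapping.lookup \<alpha> (n - i)) [0..<n]"

definition standard_mons :: "nat \<Rightarrow> nat \<Rightarrow> mon set" where
  "standard_mons n k = {\<alpha>. in_vars n \<alpha> \<and> rev_exponents n \<alpha> \<in> greedy_lists k n 0}"

lemma inj_on_rev_exponents: "inj_on (rev_exponents n) {\<alpha>. in_vars n \<alpha>}"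
proof (rule inj_onI, rule poly_mapping_eqI)
  fix \<alpha> \<beta> i
  assume a: "\<alpha> \<in> {\<alpha>. in_vars n \<alpha>}" "\<beta> \<in> {\<alpha>. in_vars n \<alpha>}" "rev_exponents n \<alpha> = rev_exponents n \<beta>"
  show "Poly_Mapping.lookup \<alpha> i = Poly_Mapping.lookup \<beta> i"
  proof (cases "i \<in> {1..n}")
    case True
    then have "rev_exponents n \<gamma> ! (n - i) = Poly_Mapping.lookup \<gamma> i" for \<gamma>
      by (simp add: rev_exponents_def)
    then show ?thesis using a(3) by metis
  next
    case False
    then show ?thesis using a in_vars_lookup[of n _ i] by simp
  qed
qed

lemma standard_mons_card:
  assumes "k \<le> n"
  shows "finite (standard_mons n k)" "card (standard_mons n k) \<le> card (label_lists k n {})"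
proof -
  have inj: "inj_on (rev_exponents n) (standard_mons n k)"
    by (rule inj_on_subset[OF inj_on_rev_exponents]) (auto simp: standard_mons_def)
  have sub: "rev_exponents n ` standard_mons n k \<subseteq> greedy_lists k n 0"
    by (auto simp: standard_mons_def)
  show "finite (standard_mons n k)"
    using inj sub finite_greedy_lists by (rule inj_on_finite)
  show "card (standard_mons n k) \<le> card (label_lists k n {})"
    using card_inj_on_le[OF inj sub finite_greedy_lists] card_greedy_eq_card_label[OF assms] by simp
qed

lemma mon_dvd_imp_add: "mon_dvd \<alpha> \<beta> \<Longrightarrow> \<beta> = (\<beta> - \<alpha>) + \<alpha>"
  by (rule poly_mapping_eqI) (simp add: mon_dvd_def lookup_add lookup_minus)

text \<open>An exponent of at least k gives a multiple of some x_i^k. If all exponents are below k,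
  the scan stops short of k and supplies a set S.\<close>

lemma nonstandard_mon_divisible:
  assumes k: "1 \<le> k" "k \<le> n" and \<alpha>: "in_vars n \<alpha>" "\<alpha> \<notin> standard_mons n k"
  shows "\<exists>g \<beta>. g \<in> (GB_set n k :: ('a::field) mpoly set) \<and> g \<noteq> 0 \<and> \<alpha> = \<beta> + lm g"
proof (cases "\<exists>i\<in>{1..n}. k \<le> Poly_Mapping.lookup \<alpha> i")
  case True
  then obtain i where i: "i \<in> {1..n}" "k \<le> Poly_Mapping.lookup \<alpha> i" by blast
  have lead: "monic_lead (h_poly k i :: 'a mpoly) (Poly_Mapping.single i k)"
    using i by (intro monic_lead_h_poly) auto
  have "mon_dvd (Poly_Mapping.single i k) \<alpha>"
    using i by (simp add: mon_dvd_def lookup_single when_def)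
  then have "\<alpha> = (\<alpha> - Poly_Mapping.single i k) + lm (h_poly k i :: 'a mpoly)"
    unfolding monic_lead_props(2)[OF lead] by (rule mon_dvd_imp_add)
  moreover have "(h_poly k i :: 'a mpoly) \<in> GB_set n k" using i by (auto simp: GB_set_def)
  ultimately show ?thesis using monic_lead_props(1)[OF lead] by blast
next
  case False
  let ?bs = "rev_exponents n \<alpha>"
  have nth: "?bs ! i = Poly_Mapping.lookup \<alpha> (n - i)" if "i < n" for i
    using that by (simp add: rev_exponents_def)
  have len: "length ?bs = n" by (simp add: rev_exponents_def)
  have small: "?bs ! i < k" if "i < n" for i
    using False that nth[OF that] by (auto simp: not_le)
  then have "set ?bs \<subseteq> {..<k}" using len by (auto simp: in_set_conv_nth)
  then have "greedy 0 ?bs < k"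
    using \<alpha> len by (auto simp: standard_mons_def greedy_lists_def)
  then obtain S where S: "S \<subseteq> {1..n - 1}" "card S = n - k + 1"
      "\<And>s. s \<in> S \<Longrightarrow> s - card {t \<in> S. t \<le> s} + 1 \<le> ?bs ! (s - 1)"
    using greedy_fails_imp_gammaS[OF k len small] by blast
  let ?g = "kappa (rev (gammaS n S)) :: 'a mpoly"
  note lead = kappa_gammaS(2)[OF k S(1,2), where 'a = 'a]
  have "mon_dvd (gamma_mon n S) \<alpha>"
    unfolding mon_dvd_def
  proof
    fix i
    show "Poly_Mapping.lookup (gamma_mon n S) i \<le> Poly_Mapping.lookup \<alpha> i"
    proof (cases "i \<in> {1..n} \<and> n + 1 - i \<in> S")
      case True
      then have "?bs ! (n + 1 - i - 1) = Poly_Mapping.lookup \<alpha> i" using nth[of "n - i"] by simp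
      then show ?thesis using S(3)[of "n + 1 - i"] True unfolding lookup_gamma_mon by simp
    qed (simp only: lookup_gamma_mon if_False)
  qed
  then have "\<alpha> = (\<alpha> - gamma_mon n S) + lm ?g"
    unfolding monic_lead_props(2)[OF lead] by (rule mon_dvd_imp_add)
  moreover have "?g \<in> GB_set n k" using S by (auto simp: GB_set_def)
  ultimately show ?thesis using monic_lead_props(1)[OF lead] by blast
qed

section \<open>The ideal of leading monomials and minimality\<close>

lemma ideal_gen_subsetI:
  assumes "\<And>g. g \<in> G \<Longrightarrow> g \<in> ideal_gen n H"
  shows "ideal_gen n G \<subseteq> ideal_gen n H"
proof
  fix f assume "f \<in> ideal_gen n G"
  then show "f \<in> ideal_gen n H"
    by (induction rule: ideal_gen.induct) (auto intro: assms ideal_gen.zero ideal_gen.add ideal_gen.mult)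
qed

lemma J_ideal_subset_poly_ring: "J_ideal n k \<subseteq> (poly_ring n :: ('a::field) mpoly set)"
proof
  fix f :: "'a mpoly" assume "f \<in> J_ideal n k"
  then show "f \<in> poly_ring n"
    unfolding J_ideal_def
  proof (induction rule: ideal_gen.induct)
    case (gen g)
    have "h_poly k i \<in> (poly_ring n :: 'a mpoly set)" if "i \<in> {1..n}" for i
      unfolding h_poly_eq_hsym using that by (intro poly_ring_hsym) auto
    moreover have "e_poly d n \<in> (poly_ring n :: 'a mpoly set)" for d
      unfolding e_poly_eq_esym by (intro poly_ring_mult poly_ring_minus_one_power poly_ring_esym)
    ultimately show ?case using gen by blast
  qed (auto intro: poly_ring_add poly_ring_mult)
qed

lemma GB_set_subset_J_ideal:
  assumes "1 \<le> k" "k \<le> n"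
  shows "GB_set n k \<subseteq> (J_ideal n k :: ('a::field) mpoly set)"
proof
  fix g :: "'a mpoly" assume "g \<in> GB_set n k"
  then consider i where "g = h_poly k i" "i \<in> {1..n}" |
      S where "g = kappa (rev (gammaS n S))" "S \<subseteq> {1..n - 1}" "card S = n - k + 1"
    unfolding GB_set_def by blast
  then show "g \<in> J_ideal n k"
  proof cases
    case 1
    then have "g \<in> {h_poly k i |i. i \<in> {1..n}} \<union> {e_poly d n |d. d \<in> {n - k + 1..n}}" by blast
    then show ?thesis unfolding J_ideal_def by (rule ideal_gen.gen)
  next
    case 2
    then show ?thesis using kappa_gammaS(1)[OF assms] by simp
  qed
qed

lemma finite_GB_set: "finite (GB_set n k)"
proof -
  have "finite (kappa ` (\<lambda>S. rev (gammaS n S)) ` Pow {1..n - 1})" by simp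
  moreover have "{kappa (rev (gammaS n S)) | S. S \<subseteq> {1..n-1} \<and> card S = n - k + 1} \<subseteq>
     kappa ` (\<lambda>S. rev (gammaS n S)) ` Pow {1..n - 1}" by auto
  ultimately have "finite {kappa (rev (gammaS n S)) | S. S \<subseteq> {1..n-1} \<and> card S = n - k + 1}"
    by (rule finite_subset[rotated])
  then show ?thesis unfolding GB_set_def by simp
qed

lemma GB_set_is_groebner_basis:
  assumes "1 \<le> k" "k \<le> n"
  shows "is_groebner_basis n (GB_set n k) (J_ideal n k :: ('a::field) mpoly set)"
proof -
  have "lm_ideal n (GB_set n k) \<subseteq> lm_ideal n (J_ideal n k :: 'a mpoly set)"
    unfolding lm_ideal_def using GB_set_subset_J_ideal[OF assms, where 'a = 'a]
    by (intro ideal_gen_subsetI ideal_gen.gen) blast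
  moreover have "lm_ideal n (J_ideal n k) \<subseteq> lm_ideal n (GB_set n k :: 'a mpoly set)"
    unfolding lm_ideal_def
  proof (rule ideal_gen_subsetI)
    fix h :: "'a mpoly" assume "h \<in> {Poly_Mapping.single (lm f) 1 |f. f \<in> (J_ideal n k :: 'a mpoly set) \<and> f \<noteq> 0}"
    then obtain f :: "'a mpoly" where f: "h = Poly_Mapping.single (lm f) 1" "f \<in> J_ideal n k" "f \<noteq> 0" by blast
    have iv: "in_vars n (lm f)"
      using f J_ideal_subset_poly_ring lm_max(1)[OF f(3)] by (auto simp: poly_ring_def)
    have "lm f \<notin> standard_mons n k"
    proof (rule leading_monomial_not_standard[OF assms(1) standard_mons_card[OF assms(2)] _ f(2,3)])
      fix \<alpha> assume "in_vars n \<alpha>" "\<alpha> \<notin> standard_mons n k"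
      then show "\<exists>g \<beta>. g \<in> (J_ideal n k :: 'a mpoly set) \<and> g \<noteq> 0 \<and> \<alpha> = \<beta> + lm g"
        using nonstandard_mon_divisible[OF assms, where 'a = 'a] GB_set_subset_J_ideal[OF assms, where 'a = 'a] by blast
    qed
    then obtain g \<beta> where g: "g \<in> (GB_set n k :: 'a mpoly set)" "g \<noteq> 0" "lm f = \<beta> + lm g"
      using nonstandard_mon_divisible[OF assms iv, where 'a = 'a] by blast
    have "h = Poly_Mapping.single \<beta> 1 * Poly_Mapping.single (lm g) 1"
      by (simp add: f(1) g(3) mult_single)
    moreover have "in_vars n \<beta>" using iv g(3) by simp
    moreover have "Poly_Mapping.single (lm g) 1 \<in>
        ideal_gen n {Poly_Mapping.single (lm f) 1 |f. f \<in> (GB_set n k :: 'a mpoly set) \<and> f \<noteq> 0}"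
      using g by (intro ideal_gen.gen) blast
    ultimately show "h \<in> ideal_gen n {Poly_Mapping.single (lm f) 1 |f. f \<in> (GB_set n k :: 'a mpoly set) \<and> f \<noteq> 0}"
      by (auto intro: ideal_gen.mult poly_ring_single)
  qed
  ultimately show ?thesis
    unfolding is_groebner_basis_def initial_ideal_def
    using GB_set_subset_J_ideal[OF assms] finite_GB_set by auto
qed

text \<open>The part at s is one more than the number of elements of {1..s} outside S, and {1..n-1}
  has only k - 2 elements outside S. So no x_i^k divides the leading monomial of a Demazure
  character.\<close>

lemma gammaS_value_bound:
  assumes "S \<subseteq> {1..n - 1}" "card S = n - k + 1" "s \<in> S" "1 \<le> k" "k \<le> n"
  shows "s - card {t \<in> S. t \<le> s} + 1 < k"
proof -
  have fin: "finite S" using assms(1) finite_subset by blast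
  have "{1..s} - S = {1..s} - {t \<in> S. t \<le> s}" by auto
  then have "card ({1..s} - S) = s - card {t \<in> S. t \<le> s}"
    using card_Diff_subset[of "{t \<in> S. t \<le> s}" "{1..s}"] assms(1) fin by (auto simp: subset_iff)
  moreover have "card ({1..s} - S) \<le> card ({1..n - 1} - S)"
    using assms(1,3) by (intro card_mono) auto
  moreover have "card ({1..n - 1} - S) = n - 1 - (n - k + 1)"
    using assms(1,2) fin by (simp add: card_Diff_subset)
  moreover have "n - k + 1 \<le> n - 1"
    using card_mono[OF _ assms(1)] assms(2) by simp
  ultimately show ?thesis using assms by linarith
qed

theorem mainTheorem6:
  fixes n k :: nat
  assumes "1 \<le> k" and "k \<le> n"
  shows "is_groebner_basis n (GB_set n k :: ('a::field) mpoly set) (J_ideal n k) \<and>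
    (k < n \<longrightarrow> is_minimal_groebner_basis n (GB_set n k :: ('a::field) mpoly set) (J_ideal n k))"
proof (intro conjI impI)
  show gb: "is_groebner_basis n (GB_set n k :: 'a mpoly set) (J_ideal n k)"
    by (rule GB_set_is_groebner_basis[OF assms])
  assume "k < n"
  let ?h = "\<lambda>i. h_poly k i :: 'a mpoly" and ?\<kappa> = "\<lambda>S. kappa (rev (gammaS n S)) :: 'a mpoly"
  define adm where "adm S \<longleftrightarrow> S \<subseteq> {1..n - 1} \<and> card S = n - k + 1" for S
  have GB: "(\<exists>i\<in>{1..n}. g = ?h i) \<or> (\<exists>S. adm S \<and> g = ?\<kappa> S)" if "g \<in> GB_set n k" for g :: "'a mpoly"
    using that unfolding GB_set_def adm_def by blast
  have h: "monic_lead (?h i) (Poly_Mapping.single i k)" if "i \<in> {1..n}" for i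
    using that by (intro monic_lead_h_poly) auto
  have \<kappa>: "monic_lead (?\<kappa> S) (gamma_mon n S)" if "adm S" for S
    using that unfolding adm_def by (intro kappa_gammaS(2)[OF assms]) auto
  \<comment> \<open>The summand 1 in the parts keeps them positive, so the support of the monomial
    recovers S.\<close>
  have pos: "Poly_Mapping.lookup (gamma_mon n S) (n + 1 - s) > 0 \<longleftrightarrow> s \<in> S" if "s \<in> {1..n}" for s S
  proof -
    have "n + 1 - s \<in> {1..n}" "n + 1 - (n + 1 - s) = s" using that by auto
    then show ?thesis unfolding lookup_gamma_mon by simp
  qed
  have in_range: "s \<in> {1..n}" if "adm S" "s \<in> S" for s S
    using that subsetD[of S "{1..n - 1}" s] unfolding adm_def by auto
  have lc: "g \<noteq> 0 \<and> lc g = 1" if "g \<in> GB_set n k" for g :: "'a mpoly"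
    using GB[OF that] monic_lead_props[OF h] monic_lead_props[OF \<kappa>] by metis
  have "\<not> mon_dvd (lm g) (lm g')" if g: "g \<in> GB_set n k" "g' \<in> GB_set n k" "g \<noteq> g'" for g g' :: "'a mpoly"
  proof
    assume dvd: "mon_dvd (lm g) (lm g')"
    consider (hh) i j where "i \<in> {1..n}" "j \<in> {1..n}" "g = ?h i" "g' = ?h j" |
      (hk) i T where "i \<in> {1..n}" "adm T" "g = ?h i" "g' = ?\<kappa> T" |
      (kh) S j where "adm S" "j \<in> {1..n}" "g = ?\<kappa> S" "g' = ?h j" |
      (kk) S T where "adm S" "adm T" "g = ?\<kappa> S" "g' = ?\<kappa> T"
      using GB[OF g(1)] GB[OF g(2)] by blast
    then show False
    proof cases
      case hh
      then have "lm g = Poly_Mapping.single i k" "lm g' = Poly_Mapping.single j k"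
        using monic_lead_props(2)[OF h] by simp_all
      then have "k \<le> (k when j = i)" using dvd[unfolded mon_dvd_def, rule_format, of i] by (simp add: lookup_single)
      then have "i = j" using assms(1) by (auto simp: when_def split: if_splits)
      then show False using hh g(3) by simp
    next
      case hk
      then have "lm g = Poly_Mapping.single i k" "lm g' = gamma_mon n T"
        using monic_lead_props(2)[OF h] monic_lead_props(2)[OF \<kappa>] by simp_all
      then have le: "k \<le> Poly_Mapping.lookup (gamma_mon n T) i"
        using dvd[unfolded mon_dvd_def, rule_format, of i] by (simp add: lookup_single)
      then have "n + 1 - i \<in> T" using assms(1) hk(1) by (auto simp: lookup_gamma_mon split: if_splits)
      then show False using le gammaS_value_bound[of T n k "n + 1 - i"] hk(1,2) assms
        by (simp add: lookup_gamma_mon adm_def)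
    next
      case kh
      then have lm: "lm g = gamma_mon n S" "lm g' = Poly_Mapping.single j k"
        using monic_lead_props(2)[OF h] monic_lead_props(2)[OF \<kappa>] by simp_all
      have "s = n + 1 - j" if "s \<in> S" for s
      proof -
        have s: "s \<in> {1..n}" using in_range[OF kh(1) that] .
        have "0 < (k when j = n + 1 - s)"
          using dvd[unfolded mon_dvd_def lm, rule_format, of "n + 1 - s"] pos[OF s, of S] that
          by (simp add: lookup_single)
        then have "j = n + 1 - s" by (auto simp: when_def split: if_splits)
        then show ?thesis using s by simp
      qed
      then have "S \<subseteq> {n + 1 - j}" by auto
      \<comment> \<open>This contradicts k < n, by which S has at least two elements. For k = n a
        singleton {s} would give x_{n+1-s}^s, a divisor of x_{n+1-s}^n.\<close>
      then have "card S \<le> 1" using card_mono[of "{n + 1 - j}" S] by simp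
      then show False using kh(1) \<open>k < n\<close> by (simp add: adm_def)
    next
      case kk
      then have lm: "lm g = gamma_mon n S" "lm g' = gamma_mon n T"
        using monic_lead_props(2)[OF \<kappa>] by simp_all
      \<comment> \<open>Divisibility includes the supports in each other, and sets of equal size
        then coincide.\<close>
      have "S \<subseteq> T"
      proof
        fix s assume s: "s \<in> S"
        have sn: "s \<in> {1..n}" using in_range[OF kk(1) s] .
        then have "0 < Poly_Mapping.lookup (gamma_mon n T) (n + 1 - s)"
          using dvd[unfolded mon_dvd_def lm, rule_format, of "n + 1 - s"] pos[OF sn, of S] s by simp
        then show "s \<in> T" using pos[OF sn, of T] by simp
      qed
      moreover have "finite T" using kk(2) finite_subset unfolding adm_def by blast
      ultimately have "S = T" using kk(1,2) by (intro card_subset_eq) (auto simp: adm_def)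
      then show False using kk g(3) by simp
    qed
  qed
  then show "is_minimal_groebner_basis n (GB_set n k :: 'a mpoly set) (J_ideal n k)"
    unfolding is_minimal_groebner_basis_def using gb lc by blast
qed

end
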